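(* Let $X$ be a separable Banach space with norm $\|\cdot\|$. Fix a collection $\Lambda$ of distance-like functions $\rho:X\times X\to[0,1]$. Consider a family of Markov kernels $P_t^\theta$ on $X$ indexed by $t\in\mathbb R^+$ and a parameter $\theta$ varying in some set $\Theta$. Assume the following conditions: (H1) There exists a constant $\gamma\ge1$ such that for every $\rho\in\Lambda$ and $\alpha>0$ the distance-like function $\rho_\alpha$ satisfies $$\rho_\alpha(u,v)\le C\,[\rho_{\gamma\alpha}(u,w)+\rho_{\gamma\alpha}(w,v)]$$ for all $u,v,w\in X$ and for some constant $C>0$ (which may depend on $\rho$, $\alpha$ and $\gamma$). (H2) For each $\theta\in\Theta$, there exists a probability measure $\mu_\theta$ on $X$ which is invariant under $P_t^\theta$, $t\in\mathbb R^+$. (H3) There exist $\theta_0\in\Theta$ and $\alpha'>0$ such that for each $\alpha\in(0,\alpha']$ and for each $\rho\in\Lambda$ there exist functions $g:\Theta\to\mathbb R^+$, $R:\mathbb R^+\to\mathbb R^+$, and a measurable function $f:X\to\mathbb R^+\cup\{\infty\}$ such that $$\mathcal W_{\rho_\alpha}(P_t^\theta(u,\cdot),P_t^{\theta_0}(u,\cdot))\le R(t)f(u)g(\theta)$$ for all $\theta\in\Theta$, $t\in\mathbb R^+$ and $u\in X$. (H4) For every $m\ge1$, there exists $\alpha_m>0$ such that for each $\alpha\in(0,\alpha_m]$ there exist $\rho\in\Lambda$, $T>0$ and constants $C_1,C_2>0$ for which $$\sup_{\theta\in\Theta\setminus\{\theta_0\}}\mathcal W_{\rho_\alpha}(\mu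 P_t^\theta,\tilde\mu P_t^\theta)\le C_1e^{-tC_2}\,\mathcal W_{\rho_{\alpha/m}}(\mu,\tilde\mu)$$ for every $\mu,\tilde\mu\in\Pr(X)$ and $t\ge T$, with $\theta_0\in\Theta$ as in (H3). Then there exists $\alpha_*>0$ such that for each fixed $\alpha\in(0,\alpha_*]$ there exist $\rho\in\Lambda$, $\tilde T>0$ and a constant $C>0$ for which $$\mathcal W_{\rho_\alpha}(\mu_\theta,\mu_{\theta_0})\le C\,R(\tilde T)\,g(\theta)\int_Xf(u)\,\mu_{\theta_0}(du)$$ for every $\theta\in\Theta$, where $R$, $g$, $f$ are the functions from (H3).
   Context: $\Pr(X)$ is the set of Borel probability measures on $X$. A Markov kernel $P$ on $X$ is a map $(u,\mathcal O)\mapsto P(u,\mathcal O)\in[0,1]$, measurable in $u\in X$ and a Borel probability measure in $\mathcal O$; $\mu P(\mathcal O)=\int_X P(u,\mathcal O)\,\mu(du)$, and $\mu$ is invariant under $\{P_t\}_{t\ge0}$ if $\mu P_t=\mu$ for all $t\ge0$. A distance-like function on $X$ is a map $\rho:X\times X\to\mathbb R^+$ that is symmetric, lower semicontinuous, and satisfies $\rho(u,v)=0$ if and only if $u=v$. Its Wasserstein-like extension to $\Pr(X)$ is $\mathcal W_\rho(\mu,\tilde\mu)=\inf_\Gamma\int_{X\times X}\rho(u,v)\,\Gamma(du,dv)\in[0,\infty]$, the infimum being over all couplings $\Gamma$ of $\mu$ and $\tilde\mu$ (probability measures on $X\times X$ with marginals $\mu$ and $\tilde\mu$). For $\rho\in\Lambda$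 and $a>0$, $\rho_a(u,v)=\rho(u,v)^{1/2}\exp(a\|u\|^2+a\|v\|^2)$, $u,v\in X$. *)

theory Defs
  imports "HOL-Probability.Probability"
begin

text \<open>Lower semicontinuity is required jointly in the two arguments, on the product space.\<close>

definition distance_like :: "('a::topological_space \<Rightarrow> 'a \<Rightarrow> real) \<Rightarrow> bool" where
  "distance_like \<rho> \<longleftrightarrow>
     (\<forall>u v. 0 \<le> \<rho> u v) \<and>
     (\<forall>u v. \<rho> u v = \<rho> v u) \<and>
     (\<forall>p c. c < case_prod \<rho> p \<longrightarrow> (\<forall>\<^sub>F q in nhds p. c < case_prod \<rho> q)) \<and>
     (\<forall>u v. \<rho> u v = 0 \<longleftrightarrow> u = v)"

definition weighted ::
  "('a::real_normed_vector \<Rightarrow> 'a \<Rightarrow> real) \<Rightarrow> real \<Rightarrow> 'a \<Rightarrow> 'a \<Rightarrow> real" where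
  "weighted \<rho> a u v = sqrt (\<rho> u v) * exp (a * (norm u)\<^sup>2 + a * (norm v)\<^sup>2)"

abbreviation Pr :: "'a::topological_space measure set" where
  "Pr \<equiv> space (prob_algebra borel)"

text \<open>
  On a second countable space the Borel sigma-algebra of the product, used here,
  is the product of the Borel sigma-algebras.
\<close>

definition couplings ::
  "'a::topological_space measure \<Rightarrow> 'a measure \<Rightarrow> ('a \<times> 'a) measure set" where
  "couplings \<mu> \<nu> = {\<Gamma> \<in> Pr. distr \<Gamma> borel fst = \<mu> \<and> distr \<Gamma> borel snd = \<nu>}"

definition wasserstein ::
  "('a::topological_space \<Rightarrow> 'a \<Rightarrow> real) \<Rightarrow> 'a measure \<Rightarrow> 'a measure \<Rightarrow> ennreal" where
  "wasserstein \<rho> \<mu> \<nu> = (INF \<Gamma>\<in>couplings \<mu> \<nu>. \<integral>\<^sup>+ (u, v). ennreal (\<rho> u v) \<partial>\<Gamma>)"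

text \<open>
  A Markov kernel is a measurable map into \<^term>\<open>prob_algebra borel\<close>, and the action
  of a kernel \<open>K\<close> on a measure \<open>\<mu>\<close> is the Giry bind \<open>\<mu> \<bind> K\<close>, whose value
  on a Borel set \<open>A\<close> is the integral of \<open>K u A\<close> over \<open>\<mu>\<close>.
\<close>

abbreviation markov_kernel :: "('a::topological_space \<Rightarrow> 'a measure) \<Rightarrow> bool" where
  "markov_kernel K \<equiv> K \<in> borel \<rightarrow>\<^sub>M prob_algebra borel"

end

theory Submission
  imports Defs
begin

text \<open>
  Fix \<open>\<theta> \<noteq> \<theta>\<^sub>0\<close> and write \<open>\<mu>\<close>, \<open>\<nu>\<close> for the invariant measures of \<open>P = P \<theta> T\<close> and \<open>Q = P \<theta>\<^sub>0 T\<close>, \<open>c\<close> for the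
  cost \<open>weighted \<rho> \<alpha>\<close>, \<open>c'\<close> for \<open>weighted \<rho> (\<gamma> * \<alpha>)\<close>, and \<open>W\<close> for the transport costs.
  By invariance and the generalized triangle inequality,
  \<open>W c \<mu> \<nu> \<le> C * (W c' (\<mu> P) (\<nu> P) + W c' (\<nu> P) (\<nu> Q))\<close>. The contraction hypothesis with \<open>m = \<gamma>\<close> bounds
  the first term by a multiple of \<open>W c \<mu> \<nu>\<close> itself, because dividing the exponent \<open>\<gamma> * \<alpha>\<close> by \<open>m\<close> gives back
  \<open>\<alpha>\<close>; for \<open>T\<close> large the total factor is at most one half. The second term is at most the integral
  against \<open>\<nu>\<close> of the pointwise bound on \<open>W c' (P u) (Q u)\<close>. If \<open>W c \<mu> \<nu>\<close> is finite, the first term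
  can be absorbed into the left-hand side.

  Nothing, however, provides the exponential moments that would make \<open>W c \<mu> \<nu>\<close> finite, so the absorption
  needs an argument of its own (\<open>wasserstein_absorb\<close>). It uses the truncated costs \<open>min c n\<close>.
  Contraction of point masses and the trivial bound \<open>n\<close> together give, for every coupling
  \<open>\<Gamma>\<close> of \<open>\<mu>\<close> and \<open>\<nu>\<close> and with \<open>E\<close> for the bound on the second term, factor \<open>C\<close> included,
  \<open>W (min c n) \<mu> \<nu> \<le> (\<integral> min (c / 2) n \<partial>\<Gamma>) + E\<close>. Inserting an almost optimal \<open>\<Gamma> n\<close> and subtracting leaves
  \<open>\<integral> c / 2 \<partial>\<Gamma> n \<le> E\<close> on the set \<open>c \<le> n\<close>, up to a vanishing error. The mass that \<open>\<Gamma> n\<close> puts on \<open>c > n\<close> tends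
  to zero, because \<open>c\<close> is dominated by a function of the form \<open>\<phi> u + \<phi> v\<close> and the marginals of \<open>\<Gamma> n\<close>
  do not depend on \<open>n\<close>. A limit of the \<open>\<Gamma> n\<close> is then a coupling of cost at most \<open>2 * E\<close>.

  Three facts about transport costs are used: couplings with converging marginals have limit
  couplings, along which lower semicontinuous costs do not jump up (\<open>couplings_cluster\<close>); couplings can
  be glued, which gives the triangle inequality (\<open>wasserstein_triangle\<close>); and the cost between two
  mixtures is at most the mixture of the costs (\<open>wasserstein_mixture\<close>). The last two are usually proved by
  disintegration and measurable selection. Here they follow from the first one: both are easy
  when only finitely many Borel sets have to be respected, and the limit removes the restriction.
  The limit itself is a finitely additive set function on the product space, given by Tychonoff's
  theorem; it is turned into a measure by \<open>content_extends\<close>.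
\<close>

section \<open>Measures from finitely additive set functions\<close>

lemma sets_borel_Times:
  fixes A :: "'a::second_countable_topology set" and B :: "'b::second_countable_topology set"
  assumes "A \<in> sets borel" "B \<in> sets borel"
  shows "A \<times> B \<in> sets borel"
  unfolding borel_prod[symmetric] using assms by auto

lemma Pr_iff: "\<mu> \<in> Pr \<longleftrightarrow> sets \<mu> = sets borel \<and> prob_space \<mu>"
  by (auto simp: space_prob_algebra)

lemma semiring_of_rectangles:
  "semiring_of_sets UNIV {A \<times> B | A B. A \<in> sets (borel :: 'a::topological_space measure)
     \<and> B \<in> sets (borel :: 'b::topological_space measure)}" (is "semiring_of_sets UNIV ?R")
proof
  show "?R \<subseteq> Pow UNIV" by auto
  show "{} \<in> ?R" by blast
  show "a \<inter> b \<in> ?R" if "a \<in> ?R" "b \<in> ?R" for a b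
  proof -
    from that obtain A B A' B' where "a = A \<times> B" "b = A' \<times> B'"
      "A \<in> sets borel" "B \<in> sets borel" "A' \<in> sets borel" "B' \<in> sets borel" by auto
    moreover from this have "a \<inter> b = (A \<inter> A') \<times> (B \<inter> B')" by auto
    ultimately show ?thesis by blast
  qed
  show "\<exists>C\<subseteq>?R. finite C \<and> disjoint C \<and> a - b = \<Union>C" if "a \<in> ?R" "b \<in> ?R" for a b
  proof -
    from that obtain A B A' B' where ab: "a = A \<times> B" "b = A' \<times> B'"
      and m: "A \<in> sets borel" "B \<in> sets borel" "A' \<in> sets borel" "B' \<in> sets borel" by auto
    define C where "C = {(A - A') \<times> B, (A \<inter> A') \<times> (B - B')}"
    have "C \<subseteq> ?R" unfolding C_def using m by blast
    moreover have "disjoint C" unfolding C_def disjoint_def by auto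
    moreover have "a - b = \<Union>C" unfolding C_def ab by auto
    moreover have "finite C" by (simp add: C_def)
    ultimately show ?thesis by blast
  qed
qed

lemma sets_borel_rectangles:
  "sets (borel :: ('a::second_countable_topology \<times> 'b::second_countable_topology) measure) =
   sigma_sets UNIV {A \<times> B | A B. A \<in> sets borel \<and> B \<in> sets borel}"
  unfolding borel_prod[symmetric] sets_pair_measure by simp

lemma compact_inside:
  fixes \<mu> :: "'a::{second_countable_topology, complete_space} measure"
  assumes "\<mu> \<in> Pr" "A \<in> sets borel" "0 < (e::real)"
  obtains K where "K \<subseteq> A" "compact K" "measure \<mu> (A - K) < e"
proof -
  interpret prob_space \<mu> using assms by (simp add: Pr_iff)
  have s: "sets \<mu> = sets borel" using assms by (simp add: Pr_iff)
  have "emeasure \<mu> A = (SUP K\<in>{K. K \<subseteq> A \<and> compact K}. emeasure \<mu> K)"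
    by (rule inner_regular[OF s _ assms(2)]) simp
  show ?thesis
  proof (cases "measure \<mu> A < e")
    case True then show ?thesis by (intro that[of "{}"]) auto
  next
    case False
    have "ennreal (measure \<mu> A - e) < emeasure \<mu> A"
      unfolding emeasure_eq_measure using False assms(3) by (subst ennreal_less_iff) auto
    also have "\<dots> = (SUP K\<in>{K. K \<subseteq> A \<and> compact K}. emeasure \<mu> K)" by fact
    finally have "ennreal (measure \<mu> A - e) < (SUP K\<in>{K. K \<subseteq> A \<and> compact K}. emeasure \<mu> K)" .
    then obtain K where K: "K \<subseteq> A" "compact K" "ennreal (measure \<mu> A - e) < emeasure \<mu> K"
      by (auto simp: less_SUP_iff)
    have "K \<in> sets \<mu>" using K s by (simp add: borel_compact)
    then have "measure \<mu> (A - K) = measure \<mu> A - measure \<mu> K"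
      using K assms s by (intro finite_measure_Diff) auto
    moreover have "measure \<mu> A - e < measure \<mu> K"
      using K(3) unfolding emeasure_eq_measure using False by (subst (asm) ennreal_less_iff) auto
    ultimately show ?thesis using K by (intro that[of K]) auto
  qed
qed

lemma open_outside:
  fixes \<mu> :: "'a::{second_countable_topology, complete_space} measure"
  assumes "\<mu> \<in> Pr" "A \<in> sets borel" "0 < (e::real)"
  obtains U where "A \<subseteq> U" "open U" "measure \<mu> (U - A) < e"
proof -
  obtain K where "K \<subseteq> - A" "compact K" "measure \<mu> (- A - K) < e"
    using compact_inside[OF assms(1) _ assms(3), of "- A"] assms(2) by auto
  moreover have "- A - K = - K - A" by auto
  ultimately show ?thesis by (intro that[of "- K"]) (auto simp: compact_imp_closed)
qed

text \<open>
  A finitely additive set function on a product need not be countably additive, but it is so on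
  rectangles as soon as both marginals are measures on Polish spaces: a rectangle is
  exhausted by compact rectangles, the covering rectangles can be enlarged to open ones, and in both
  cases the error is controlled by the marginals alone. Caratheodory's theorem then produces a
  coupling. It need not agree with the set function beyond finite unions of rectangles; on open sets
  the inequality survives, by approximation from inside with such unions.
\<close>

lemma content_extends:
  fixes m :: "('a::{second_countable_topology, complete_space} \<times> 'a) set \<Rightarrow> real"
  assumes \<mu>: "\<mu> \<in> Pr" and \<nu>: "\<nu> \<in> Pr"
    and pos: "\<And>E. E \<in> sets borel \<Longrightarrow> 0 \<le> m E"
    and add: "\<And>E F. E \<in> sets borel \<Longrightarrow> F \<in> sets borel \<Longrightarrow> E \<inter> F = {} \<Longrightarrow> m (E \<union> F) = m E + m F"
    and left: "\<And>A. A \<in> sets borel \<Longrightarrow> m (A \<times> UNIV) = measure \<mu> A"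
    and right: "\<And>A. A \<in> sets borel \<Longrightarrow> m (UNIV \<times> A) = measure \<nu> A"
  shows "\<exists>\<Gamma>\<in>couplings \<mu> \<nu>. (\<forall>A B. A \<in> sets borel \<longrightarrow> B \<in> sets borel \<longrightarrow> measure \<Gamma> (A \<times> B) = m (A \<times> B))
     \<and> (\<forall>U. open U \<longrightarrow> measure \<Gamma> U \<le> m U)"
proof -
  interpret \<mu>: prob_space \<mu> using \<mu> by (simp add: Pr_iff)
  interpret \<nu>: prob_space \<nu> using \<nu> by (simp add: Pr_iff)
  have s\<mu>[simp]: "sets \<mu> = sets borel" and s\<nu>[simp]: "sets \<nu> = sets borel"
    using \<mu> \<nu> by (simp_all add: Pr_iff)
  have sp[simp]: "space \<mu> = UNIV" "space \<nu> = UNIV"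
    using sets_eq_imp_space_eq[OF s\<mu>] sets_eq_imp_space_eq[OF s\<nu>] by auto
  define \<R> where "\<R> = {A \<times> B | A B. A \<in> sets (borel :: 'a measure) \<and> B \<in> sets (borel :: 'a measure)}"
  interpret R: semiring_of_sets UNIV \<R> unfolding \<R>_def by (rule semiring_of_rectangles)
  have R_borel: "E \<in> sets borel" if "E \<in> \<R>" for E
    using that unfolding \<R>_def by (auto intro: sets_borel_Times)
  have m0: "m {} = 0" using add[of "{}" "{}"] by simp
  have mono: "m E \<le> m F" if "E \<in> sets borel" "F \<in> sets borel" "E \<subseteq> F" for E F
  proof -
    have "m (E \<union> (F - E)) = m E + m (F - E)" using that by (intro add) auto
    moreover have "E \<union> (F - E) = F" using that by auto
    ultimately show ?thesis using pos[of "F - E"] that by auto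
  qed
  have sub: "m (E \<union> F) \<le> m E + m F" if "E \<in> sets borel" "F \<in> sets borel" for E F
  proof -
    have "m (E \<union> (F - E)) = m E + m (F - E)" using that by (intro add) auto
    moreover have "E \<union> (F - E) = E \<union> F" by auto
    moreover have "m (F - E) \<le> m F" using that by (intro mono) auto
    ultimately show ?thesis by auto
  qed
  have fin_sub: "m (\<Union>i\<in>I. E i) \<le> (\<Sum>i\<in>I. m (E i))" if "finite I" "\<And>i. i \<in> I \<Longrightarrow> E i \<in> sets borel"
    for I :: "nat set" and E
    using that
  proof (induction I rule: finite_induct)
    case (insert x I)
    have "(\<Union>i\<in>insert x I. E i) = E x \<union> (\<Union>i\<in>I. E i)" by auto
    moreover have "m (E x \<union> (\<Union>i\<in>I. E i)) \<le> m (E x) + m (\<Union>i\<in>I. E i)"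
      using insert by (intro sub sets.finite_UN) auto
    ultimately show ?case using insert by auto
  qed (simp add: m0)
  have fin_add: "m (\<Union>C) = (\<Sum>E\<in>C. m E)" if "finite C" "disjoint C" "C \<subseteq> sets borel" for C
    using that
  proof (induction C rule: finite_induct)
    case (insert E C)
    have "m (E \<union> \<Union>C) = m E + m (\<Union>C)"
      using insert by (intro add sets.finite_Union) (auto simp: disjoint_def)
    then show ?case using insert by (auto simp: disjoint_def)
  qed (simp add: m0)
  \<comment> \<open>Shrinking the sides of a rectangle costs no more than the marginals see.\<close>
  have prob_Diff: "m (A \<times> B) \<le> m (K \<times> L) + measure \<mu> (A - K) + measure \<nu> (B - L)"
    if "A \<in> sets borel" "B \<in> sets borel" "K \<in> sets borel" "L \<in> sets borel" for A B K L
  proof -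
    have [measurable]: "A \<times> B \<in> sets borel" "K \<times> L \<in> sets borel" "(A - K) \<times> (UNIV :: 'a set) \<in> sets borel"
      "(UNIV :: 'a set) \<times> (B - L) \<in> sets borel"
      by (intro sets_borel_Times; use that in auto)+
    have "m (A \<times> B) \<le> m (K \<times> L \<union> (A - K) \<times> UNIV \<union> UNIV \<times> (B - L))"
      by (intro mono) auto
    also have "\<dots> \<le> m (K \<times> L \<union> (A - K) \<times> UNIV) + m (UNIV \<times> (B - L))" by (intro sub) auto
    also have "\<dots> \<le> m (K \<times> L) + m ((A - K) \<times> UNIV) + m (UNIV \<times> (B - L))"
      using sub[of "K \<times> L" "(A - K) \<times> UNIV"] by auto
    finally show ?thesis using left[of "A - K"] right[of "B - L"] that by auto
  qed
  have "countably_additive \<R> (\<lambda>E. ennreal (m E))"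
  proof (rule countably_additiveI)
    fix E :: "nat \<Rightarrow> ('a \<times> 'a) set"
    assume E: "range E \<subseteq> \<R>" "disjoint_family E" "(\<Union>i. E i) \<in> \<R>"
    then have Eb: "E i \<in> sets borel" for i by (auto intro: R_borel)
    have "\<exists>A B. \<forall>i. E i = A i \<times> B i \<and> A i \<in> sets borel \<and> B i \<in> sets borel"
    proof -
      have "\<forall>i. \<exists>A B. E i = A \<times> B \<and> A \<in> sets borel \<and> B \<in> sets borel"
        using E(1) unfolding \<R>_def by blast
      then show ?thesis by metis
    qed
    then obtain A B where AB: "\<And>i. E i = A i \<times> B i" "\<And>i. A i \<in> sets borel" "\<And>i. B i \<in> sets borel" by blast
    obtain A' B' where AB': "(\<Union>i. E i) = A' \<times> B'" "A' \<in> sets borel" "B' \<in> sets borel"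
      using E(3) unfolding \<R>_def by blast
    have part: "(\<Sum>i<n. m (E i)) \<le> m (\<Union>i. E i)" for n
    proof -
      have "(\<Sum>i<n. m (E i)) = m (\<Union>i<n. E i)"
      proof (induction n)
        case (Suc n)
        have "m ((\<Union>i<n. E i) \<union> E n) = m (\<Union>i<n. E i) + m (E n)"
          using E(2) Eb by (intro add) (auto simp: disjoint_family_on_def, metis Int_iff empty_iff less_irrefl)
        then show ?case using Suc by (simp add: lessThan_Suc Un_commute)
      qed (simp add: m0)
      also have "\<dots> \<le> m (\<Union>i. E i)" using Eb by (intro mono) auto
      finally show ?thesis .
    qed
    have summ: "summable (\<lambda>i. m (E i))"
      using part pos Eb by (intro summableI_nonneg_bounded[of _ "m (\<Union>i. E i)"]) auto
    have le: "(\<Sum>i. m (E i)) \<le> m (\<Union>i. E i)"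
      by (intro suminf_le_const[OF summ part])
    \<comment> \<open>Compactness reduces the countable cover to a finite one, at a cost of at most \<open>4 * e\<close>.\<close>
    have ge: "m (\<Union>i. E i) \<le> (\<Sum>i. m (E i)) + 4 * e" if e: "0 < e" for e
    proof -
      obtain K where K: "K \<subseteq> A'" "compact K" "measure \<mu> (A' - K) < e"
        using compact_inside[OF \<mu> AB'(2) e] .
      obtain L where L: "L \<subseteq> B'" "compact L" "measure \<nu> (B' - L) < e"
        using compact_inside[OF \<nu> AB'(3) e] .
      define d where "d i = e * (1/2) ^ Suc i" for i :: nat
      have d: "0 < d i" for i using e by (simp add: d_def)
      have "\<exists>U. A i \<subseteq> U \<and> open U \<and> measure \<mu> (U - A i) < d i" for i
        by (rule open_outside[OF \<mu> AB(2)[of i] d[of i]]) blast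
      moreover have "\<exists>V. B i \<subseteq> V \<and> open V \<and> measure \<nu> (V - B i) < d i" for i
        by (rule open_outside[OF \<nu> AB(3)[of i] d[of i]]) blast
      ultimately have "\<exists>U V. \<forall>i. A i \<subseteq> U i \<and> open (U i) \<and> measure \<mu> (U i - A i) < d i
              \<and> B i \<subseteq> V i \<and> open (V i) \<and> measure \<nu> (V i - B i) < d i"
        by metis
      then obtain U V where UV: "\<And>i. A i \<subseteq> U i" "\<And>i. open (U i)" "\<And>i. measure \<mu> (U i - A i) < d i"
        "\<And>i. B i \<subseteq> V i" "\<And>i. open (V i)" "\<And>i. measure \<nu> (V i - B i) < d i" by blast
      have cov: "K \<times> L \<subseteq> (\<Union>i\<in>UNIV. U i \<times> V i)"
      proof -
        have "K \<times> L \<subseteq> A' \<times> B'" using K L by auto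
        also have "\<dots> \<subseteq> (\<Union>i. U i \<times> V i)" unfolding AB'(1)[symmetric] AB(1)
          by (intro UN_mono Sigma_mono order_refl UV)
        finally show ?thesis .
      qed
      obtain I where I: "finite I" "K \<times> L \<subseteq> (\<Union>i\<in>I. U i \<times> V i)"
        by (rule compactE_image[OF compact_Times[OF K(2) L(2)], of UNIV "\<lambda>i. U i \<times> V i"])
           (use UV cov in \<open>auto intro: open_Times\<close>)
      have b: "U i \<in> sets borel" "V i \<in> sets borel" "K \<in> sets borel" "L \<in> sets borel" for i
        using UV K L by (auto intro: borel_compact)
      have "m (A' \<times> B') \<le> m (K \<times> L) + 2 * e"
        using prob_Diff[OF AB'(2,3) b(3,4)] K L by auto
      also have "m (K \<times> L) \<le> m (\<Union>i\<in>I. U i \<times> V i)"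
        using I b by (intro mono sets.finite_UN sets_borel_Times) auto
      also have "\<dots> \<le> (\<Sum>i\<in>I. m (U i \<times> V i))"
        using I b by (intro fin_sub sets_borel_Times) auto
      also have "\<dots> \<le> (\<Sum>i\<in>I. m (E i) + 2 * d i)"
      proof (rule sum_mono)
        fix i
        show "m (U i \<times> V i) \<le> m (E i) + 2 * d i"
          using prob_Diff[OF b(1,2) AB(2,3), of i i i i] UV[of i] by (auto simp: AB(1))
      qed
      also have "\<dots> = (\<Sum>i\<in>I. m (E i)) + 2 * (\<Sum>i\<in>I. d i)"
        by (simp add: sum.distrib sum_distrib_left)
      also have "(\<Sum>i\<in>I. m (E i)) \<le> (\<Sum>i. m (E i))"
        using I pos Eb by (intro sum_le_suminf summ) auto
      also have "(\<Sum>i\<in>I. d i) \<le> e"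
      proof -
        have "d sums (e * 1)"
          unfolding d_def by (intro sums_mult power_half_series)
        then show ?thesis using I d sum_le_suminf[of d I] by (auto simp: sums_iff less_imp_le)
      qed
      finally show ?thesis unfolding AB'(1) by simp
    qed
    have "(\<Sum>i. m (E i)) = m (\<Union>i. E i)"
    proof (rule antisym[OF le])
      show "m (\<Union>i. E i) \<le> (\<Sum>i. m (E i))"
        by (rule field_le_epsilon) (use ge[of "e/4" for e] in auto)
    qed
    then show "(\<Sum>i. ennreal (m (E i))) = ennreal (m (\<Union>i. E i))"
      using pos Eb summ by (subst suminf_ennreal2) auto
  qed
  moreover have "positive \<R> (\<lambda>E. ennreal (m E))" by (simp add: positive_def m0)
  ultimately obtain M where M: "\<And>E. E \<in> \<R> \<Longrightarrow> M E = ennreal (m E)"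
    "measure_space UNIV (sigma_sets UNIV \<R>) M"
    using R.caratheodory by blast
  define \<Gamma> where "\<Gamma> = measure_of UNIV (sets borel) M"
  have sig: "sigma_sets UNIV \<R> = sets borel" unfolding \<R>_def sets_borel_rectangles ..
  have s\<Gamma>: "sets \<Gamma> = sets borel" "space \<Gamma> = UNIV"
    unfolding \<Gamma>_def using sets.sigma_sets_eq[of "borel :: ('a \<times> 'a) measure"] by simp_all
  have e\<Gamma>: "emeasure \<Gamma> E = M E" if "E \<in> sets borel" for E
    unfolding \<Gamma>_def using M(2) that unfolding measure_space_def sig
    by (intro emeasure_measure_of_sigma) (auto simp: sigma_algebra_def)
  have rect: "emeasure \<Gamma> (A \<times> B) = ennreal (m (A \<times> B))" if "A \<in> sets borel" "B \<in> sets borel" for A B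
    using that e\<Gamma>[OF sets_borel_Times, of A B] M(1)[of "A \<times> B"] unfolding \<R>_def by auto
  have marg: "distr \<Gamma> borel fst = \<mu>" "distr \<Gamma> borel snd = \<nu>"
  proof -
    have f: "fst \<in> \<Gamma> \<rightarrow>\<^sub>M borel" "snd \<in> \<Gamma> \<rightarrow>\<^sub>M borel"
      using s\<Gamma> by (auto simp: borel_prod[symmetric] cong: measurable_cong_sets)
    have v: "fst -` A = A \<times> UNIV" "snd -` A = UNIV \<times> A" for A :: "'a set" by auto
    show "distr \<Gamma> borel fst = \<mu>"
      by (rule measure_eqI) (auto simp: emeasure_distr f s\<Gamma> v rect left \<mu>.emeasure_eq_measure)
    show "distr \<Gamma> borel snd = \<nu>"
      by (rule measure_eqI) (auto simp: emeasure_distr f s\<Gamma> v rect right \<nu>.emeasure_eq_measure)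
  qed
  have prob: "prob_space \<Gamma>"
    by (rule prob_spaceI) (use rect[of UNIV UNIV] left[of UNIV] \<mu>.prob_space s\<Gamma> in auto)
  interpret \<Gamma>: prob_space \<Gamma> by (rule prob)
  have "\<Gamma> \<in> couplings \<mu> \<nu>" unfolding couplings_def using marg prob s\<Gamma> by (auto simp: Pr_iff)
  moreover have rect': "measure \<Gamma> (A \<times> B) = m (A \<times> B)" if "A \<in> sets borel" "B \<in> sets borel" for A B
    using rect[OF that] pos[OF sets_borel_Times[OF that]] by (simp add: measure_def)
  moreover have "measure \<Gamma> U \<le> m U" if "open U" for U
  proof (rule field_le_epsilon)
    fix e :: real assume "0 < e"
    have Ub: "U \<in> sets borel" using that by simp
    obtain K where K: "K \<subseteq> U" "compact K" "measure \<Gamma> (U - K) < e"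
      using compact_inside[OF _ Ub \<open>0 < e\<close>, of \<Gamma>] prob s\<Gamma> by (auto simp: Pr_iff)
    have "\<forall>x\<in>K. \<exists>V W. open V \<and> open W \<and> x \<in> V \<times> W \<and> V \<times> W \<subseteq> U"
      using that K(1) unfolding open_prod_def by auto
    then obtain V W where VW: "\<And>x. x \<in> K \<Longrightarrow> open (V x) \<and> open (W x) \<and> x \<in> V x \<times> W x \<and> V x \<times> W x \<subseteq> U"
      by metis
    obtain I where I: "I \<subseteq> K" "finite I" "K \<subseteq> (\<Union>x\<in>I. V x \<times> W x)"
      by (rule compactE_image[OF K(2), of K "\<lambda>x. V x \<times> W x"]) (use VW in \<open>auto intro: open_Times\<close>)
    interpret G: ring_of_sets UNIV R.generated_ring by (rule R.generating_ring)
    \<comment> \<open>A finite union of rectangles can be rewritten as a disjoint one, where \<open>m\<close> and \<open>\<Gamma>\<close> add up alike.\<close>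
    have "(\<Union>x\<in>I. V x \<times> W x) \<in> R.generated_ring"
    proof (rule G.finite_UN)
      show "finite I" by fact
      show "V x \<times> W x \<in> R.generated_ring" if "x \<in> I" for x
      proof -
        have "V x \<in> sets borel" "W x \<in> sets borel" using that I VW[of x] by auto
        then show ?thesis by (intro R.generated_ringI_Basic) (auto simp: \<R>_def)
      qed
    qed
    then obtain C where C: "finite C" "disjoint C" "C \<subseteq> \<R>" "(\<Union>x\<in>I. V x \<times> W x) = \<Union>C"
      by (rule R.generated_ringE)
    have Cb: "C \<subseteq> sets borel" using C R_borel by auto
    have "measure \<Gamma> U = measure \<Gamma> K + measure \<Gamma> (U - K)"
      using K Ub s\<Gamma> by (subst \<Gamma>.finite_measure_Diff) (auto intro: borel_compact)
    also have "measure \<Gamma> K \<le> measure \<Gamma> (\<Union>C)"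
      using I C Cb s\<Gamma> by (intro \<Gamma>.finite_measure_mono) (auto intro!: sets.finite_Union)
    also have "\<dots> \<le> (\<Sum>E\<in>C. measure \<Gamma> E)"
      using measure_UNION_le[OF C(1), of "\<lambda>E. E" \<Gamma>] Cb s\<Gamma> by (simp add: subset_iff)
    also have "\<dots> = (\<Sum>E\<in>C. m E)"
      using C(3) rect' unfolding \<R>_def by (intro sum.cong) auto
    also have "\<dots> = m (\<Union>C)" using fin_add[OF C(1,2) Cb] ..
    also have "\<dots> \<le> m U"
      using VW I C(4)[symmetric] Ub Cb C(1) by (intro mono sets.finite_Union) auto
    finally show "measure \<Gamma> U \<le> m U + e" using K by auto
  qed
  ultimately show ?thesis by blast
qed

section \<open>Limits of couplings\<close>

definition lsc :: "('b::topological_space \<Rightarrow> real) \<Rightarrow> bool" where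
  "lsc c \<longleftrightarrow> (\<forall>t. open {p. t < c p})"

lemma lsc_borel: "lsc c \<Longrightarrow> c \<in> borel_measurable borel"
  unfolding lsc_def by (intro borel_measurable_iff_greater[THEN iffD2]) auto

lemma couplingsD:
  assumes "\<Gamma> \<in> couplings \<mu> \<nu>"
  shows "prob_space \<Gamma>" "sets \<Gamma> = sets borel" "space \<Gamma> = UNIV"
    "distr \<Gamma> borel fst = \<mu>" "distr \<Gamma> borel snd = \<nu>"
proof -
  show "sets \<Gamma> = sets borel" "prob_space \<Gamma>" "distr \<Gamma> borel fst = \<mu>" "distr \<Gamma> borel snd = \<nu>"
    using assms by (auto simp: couplings_def Pr_iff)
  then show "space \<Gamma> = UNIV" using sets_eq_imp_space_eq by fastforce
qed

lemma measurable_fst_snd_borel: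
  fixes \<Gamma> :: "('a::second_countable_topology \<times> 'a) measure"
  assumes "sets \<Gamma> = sets borel"
  shows "fst \<in> \<Gamma> \<rightarrow>\<^sub>M borel" "snd \<in> \<Gamma> \<rightarrow>\<^sub>M borel"
  using assms by (auto simp: borel_prod[symmetric] cong: measurable_cong_sets)

lemma coupling_marginals:
  fixes \<Gamma> :: "('a::second_countable_topology \<times> 'a) measure"
  assumes "\<Gamma> \<in> couplings \<mu> \<nu>" "A \<in> sets borel"
  shows "measure \<Gamma> (A \<times> UNIV) = measure \<mu> A" "measure \<Gamma> (UNIV \<times> A) = measure \<nu> A"
proof -
  note c = couplingsD[OF assms(1)]
  have v: "fst -` A \<inter> space \<Gamma> = A \<times> UNIV" "snd -` A \<inter> space \<Gamma> = UNIV \<times> A" using c by auto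
  show "measure \<Gamma> (A \<times> UNIV) = measure \<mu> A"
    using measure_distr[OF measurable_fst_snd_borel(1)[OF c(2)] assms(2)] c(4) v by simp
  show "measure \<Gamma> (UNIV \<times> A) = measure \<nu> A"
    using measure_distr[OF measurable_fst_snd_borel(2)[OF c(2)] assms(2)] c(5) v by simp
qed

text \<open>
  This is Tychonoff's theorem for \<open>[0, 1]\<close> to an arbitrary power, phrased so that the limit of each single
  coordinate can be handled with the usual rules for \<^const>\<open>filterlim\<close>. A subsequence would not do:
  the coordinates below are all the sets of the product space, which are uncountably many.
\<close>

lemma compact_subfilter:
  fixes \<phi> :: "'i \<Rightarrow> 'j \<Rightarrow> real"
  assumes "F \<noteq> bot" "\<And>i j. 0 \<le> \<phi> i j \<and> \<phi> i j \<le> 1"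
  obtains G x where "G \<noteq> bot" "G \<le> F" "\<And>j. ((\<lambda>i. \<phi> i j) \<longlongrightarrow> x j) G"
proof -
  have "compactin (product_topology (\<lambda>j::'j. euclidean :: real topology) UNIV) (PiE UNIV (\<lambda>_. {0..1}))"
    by (simp add: compactin_PiE)
  then have "compact (PiE UNIV (\<lambda>_. {0..1}) :: ('j \<Rightarrow> real) set)"
    by (simp add: euclidean_product_topology)
  moreover have "\<forall>\<^sub>F y in filtermap \<phi> F. y \<in> PiE UNIV (\<lambda>_. {0..1})" "filtermap \<phi> F \<noteq> bot"
    using assms by (auto simp: eventually_filtermap filtermap_bot_iff intro!: always_eventually)
  ultimately obtain x where x: "inf (nhds x) (filtermap \<phi> F) \<noteq> bot"
    unfolding compact_filter by blast
  define G where "G = inf F (filtercomap \<phi> (nhds x))"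
  have "G \<noteq> bot"
  proof
    assume "G = bot"
    then have "eventually (\<lambda>_. False) (inf F (filtercomap \<phi> (nhds x)))" by (simp add: G_def)
    then obtain P Q where PQ: "eventually P F" "eventually Q (nhds x)" "\<And>i. P i \<Longrightarrow> Q (\<phi> i) \<Longrightarrow> False"
      by (fastforce simp: eventually_inf eventually_filtercomap)
    have "eventually (\<lambda>y. \<not> Q y) (filtermap \<phi> F)"
      unfolding eventually_filtermap using PQ(1) by (rule eventually_mono) (use PQ(3) in auto)
    then have "eventually (\<lambda>_. False) (inf (nhds x) (filtermap \<phi> F))"
      using PQ(2) unfolding eventually_inf by blast
    then show False using x by (simp add: trivial_limit_def)
  qed
  moreover have "G \<le> F" by (simp add: G_def)
  moreover have "((\<lambda>i. \<phi> i j) \<longlongrightarrow> x j) G" for j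
  proof -
    have "filterlim \<phi> (nhds x) G" unfolding filterlim_iff_le_filtercomap G_def by simp
    moreover have "((\<lambda>y. y j) \<longlongrightarrow> x j) (nhds x)"
    proof (rule topological_tendstoI)
      fix S :: "real set" assume "open S" "x j \<in> S"
      then show "\<forall>\<^sub>F y in nhds x. y j \<in> S"
        using open_vimage[OF _ continuous_on_product_coordinates[of j], of S]
        by (intro eventually_nhds[THEN iffD2] exI[of _ "(\<lambda>y. y j) -` S"]) auto
    qed
    ultimately show ?thesis by (rule filterlim_compose[rotated])
  qed
  ultimately show ?thesis by (rule that)
qed

text \<open>
  A nonnegative function differs by at most \<open>1\<close> from the sum of the indicators of its level sets at
  the positive integers, hence so does its integral under a probability measure from the sum of their
  measures. For a lower semicontinuous function these sets are open, so this reduces statements about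
  costs to statements about open sets.
\<close>

lemma level_sets_le:
  fixes x :: real assumes "0 \<le> x"
  shows "(\<Sum>j<n. indicator {real (Suc j)<..} x :: real) \<le> x"
proof -
  have "(\<Sum>j<n. indicator {real (Suc j)<..} x :: real) = card {j\<in>{..<n}. real (Suc j) < x}"
    by (simp add: indicator_def sum.If_cases Int_def)
  also have "card {j\<in>{..<n}. real (Suc j) < x} \<le> card {..<nat \<lfloor>x\<rfloor>}"
    by (intro card_mono) (auto, linarith)
  also have "real (card {..<nat \<lfloor>x\<rfloor>}) \<le> x" using assms by simp
  finally show ?thesis by simp
qed

lemma le_level_sets:
  fixes x :: real assumes "0 \<le> x"
  obtains n where "x \<le> 1 + (\<Sum>j<n. indicator {real (Suc j)<..} x :: real)"
proof -
  define n where "n = nat (\<lceil>x\<rceil> - 1)"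
  have "real (Suc j) < x" if "j < n" for j using that unfolding n_def by linarith
  then have "(\<Sum>j<n. indicator {real (Suc j)<..} x :: real) = n" by simp
  then show ?thesis using assms by (intro that[of n]) (simp add: n_def, linarith)
qed

lemma nn_integral_level_sets_le:
  assumes "prob_space M" and c: "c \<in> borel_measurable M" "\<And>x. 0 \<le> (c x :: real)"
  shows "ennreal (\<Sum>j<n. measure M {x\<in>space M. real (Suc j) < c x}) \<le> (\<integral>\<^sup>+x. ennreal (c x) \<partial>M)"
proof -
  interpret prob_space M by fact
  have "ennreal (\<Sum>j<n. measure M {x\<in>space M. real (Suc j) < c x})
      = (\<Sum>j<n. emeasure M {x\<in>space M. real (Suc j) < c x})"
    by (simp add: emeasure_eq_measure)
  also have "\<dots> = (\<integral>\<^sup>+x. (\<Sum>j<n. indicator {x\<in>space M. real (Suc j) < c x} x) \<partial>M)"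
    using c by (subst nn_integral_sum) (auto intro!: sum.cong nn_integral_indicator[symmetric])
  also have "\<dots> \<le> (\<integral>\<^sup>+x. ennreal (c x) \<partial>M)"
  proof (rule nn_integral_mono)
    fix x assume "x \<in> space M"
    have "(\<Sum>j<n. indicator {x\<in>space M. real (Suc j) < c x} x :: ennreal)
        = ennreal (\<Sum>j<n. indicator {real (Suc j)<..} (c x))"
      using \<open>x \<in> space M\<close> by (subst sum_ennreal[symmetric]) (auto intro!: sum.cong simp: indicator_def ennreal_of_nat_eq_real_of_nat)
    also have "\<dots> \<le> ennreal (c x)" by (intro ennreal_leI level_sets_le c)
    finally show "(\<Sum>j<n. indicator {x\<in>space M. real (Suc j) < c x} x) \<le> ennreal (c x)" .
  qed
  finally show ?thesis .
qed

lemma nn_integral_le_level_sets: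
  assumes "prob_space M" and c: "c \<in> borel_measurable M" "\<And>x. 0 \<le> (c x :: real)"
    and K: "\<And>n. ennreal (\<Sum>j<n. measure M {x\<in>space M. real (Suc j) < c x}) \<le> K"
  shows "(\<integral>\<^sup>+x. ennreal (c x) \<partial>M) \<le> 1 + K"
proof -
  interpret prob_space M by fact
  let ?L = "\<lambda>j. {x\<in>space M. real (Suc j) < c x}"
  have L: "?L j \<in> sets M" for j using c(1) by measurable
  have "(\<integral>\<^sup>+x. ennreal (c x) \<partial>M) \<le> (\<integral>\<^sup>+x. 1 + (\<Sum>j. indicator (?L j) x) \<partial>M)"
  proof (rule nn_integral_mono)
    fix x assume x: "x \<in> space M"
    obtain n where n: "c x \<le> 1 + (\<Sum>j<n. indicator {real (Suc j)<..} (c x) :: real)"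
      using le_level_sets[OF c(2)] .
    have "ennreal (c x) \<le> ennreal (1 + (\<Sum>j<n. indicator {real (Suc j)<..} (c x) :: real))"
      using n by (rule ennreal_leI)
    also have "\<dots> = 1 + ennreal (\<Sum>j<n. indicator {real (Suc j)<..} (c x) :: real)"
      by (subst ennreal_plus) (auto intro: sum_nonneg)
    also have "ennreal (\<Sum>j<n. indicator {real (Suc j)<..} (c x) :: real) = (\<Sum>j<n. indicator (?L j) x)"
      using x by (subst sum_ennreal[symmetric]) (auto intro!: sum.cong simp: indicator_def ennreal_of_nat_eq_real_of_nat)
    also have "\<dots> \<le> (\<Sum>j. indicator (?L j) x)" by (intro sum_le_suminf) auto
    finally show "ennreal (c x) \<le> 1 + (\<Sum>j. indicator (?L j) x)" by simp
  qed
  also have "\<dots> = 1 + (\<Sum>j. emeasure M (?L j))"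
    using L by (subst nn_integral_add) (auto simp: nn_integral_suminf emeasure_space_1)
  also have "(\<Sum>j. emeasure M (?L j)) \<le> K"
  proof (rule suminf_le_const)
    show "(\<Sum>j<n. emeasure M (?L j)) \<le> K" for n
      using K[of n] by (simp add: emeasure_eq_measure)
  qed auto
  finally show ?thesis by simp
qed

text \<open>
  The compactness of the set of couplings, for marginals that converge on every Borel set.
  For the cost, lower semicontinuity enters through the open level sets, on which the limit
  measure is at most the limit of the measures. The first conclusion retains information on
  rectangles that are not open; it is what locates the glued coupling on the diagonal.
\<close>

lemma couplings_cluster:
  fixes \<Gamma> :: "'i \<Rightarrow> ('a::{second_countable_topology, complete_space} \<times> 'a) measure"
  assumes F: "F \<noteq> bot" and \<Gamma>: "\<And>i. \<Gamma> i \<in> Pr" and \<mu>: "\<mu> \<in> Pr" and \<nu>: "\<nu> \<in> Pr"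
    and left: "\<And>A. A \<in> sets borel \<Longrightarrow> ((\<lambda>i. measure (\<Gamma> i) (A \<times> UNIV)) \<longlongrightarrow> measure \<mu> A) F"
    and right: "\<And>A. A \<in> sets borel \<Longrightarrow> ((\<lambda>i. measure (\<Gamma> i) (UNIV \<times> A)) \<longlongrightarrow> measure \<nu> A) F"
  shows "\<exists>\<Delta>\<in>couplings \<mu> \<nu>.
     (\<forall>A B. A \<in> sets borel \<longrightarrow> B \<in> sets borel \<longrightarrow> (\<forall>\<^sub>F i in F. measure (\<Gamma> i) (A \<times> B) = 0) \<longrightarrow>
        measure \<Delta> (A \<times> B) = 0) \<and>
     (\<forall>c K. lsc c \<longrightarrow> (\<forall>p. 0 \<le> c p) \<longrightarrow> (\<forall>e>0. \<forall>\<^sub>F i in F. (\<integral>\<^sup>+p. ennreal (c p) \<partial>\<Gamma> i) \<le> K + ennreal e) \<longrightarrow>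
        (\<integral>\<^sup>+p. ennreal (c p) \<partial>\<Delta>) \<le> K)"
proof -
  have P: "prob_space (\<Gamma> i)" and s: "sets (\<Gamma> i) = sets borel" for i using \<Gamma> by (auto simp: Pr_iff)
  have sp: "space (\<Gamma> i) = UNIV" for i using sets_eq_imp_space_eq[OF s] by simp
  interpret \<Gamma>: prob_space "\<Gamma> i" for i by (rule P)
  obtain G m where G: "G \<noteq> bot" "G \<le> F" and m: "\<And>E. ((\<lambda>i. measure (\<Gamma> i) E) \<longlongrightarrow> m E) G"
    by (rule compact_subfilter[OF F, of "\<lambda>i E. measure (\<Gamma> i) E"]) auto
  note uniq = tendsto_unique[OF G(1)]
  have "\<exists>\<Delta>\<in>couplings \<mu> \<nu>. (\<forall>A B. A \<in> sets borel \<longrightarrow> B \<in> sets borel \<longrightarrow> measure \<Delta> (A \<times> B) = m (A \<times> B))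
     \<and> (\<forall>U. open U \<longrightarrow> measure \<Delta> U \<le> m U)"
  proof (rule content_extends[OF \<mu> \<nu>])
    show "0 \<le> m E" for E
      by (rule tendsto_lowerbound[OF m _ G(1)]) simp
    show "m (E \<union> E') = m E + m E'" if "E \<in> sets borel" "E' \<in> sets borel" "E \<inter> E' = {}" for E E'
    proof (rule uniq[OF m])
      have "((\<lambda>i. measure (\<Gamma> i) E + measure (\<Gamma> i) E') \<longlongrightarrow> m E + m E') G" by (intro tendsto_add m)
      then show "((\<lambda>i. measure (\<Gamma> i) (E \<union> E')) \<longlongrightarrow> m E + m E') G"
        using that s by (subst \<Gamma>.finite_measure_Union) auto
    qed
    show "m (A \<times> UNIV) = measure \<mu> A" if "A \<in> sets borel" for A
      by (rule uniq[OF m tendsto_mono[OF G(2) left[OF that]]])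
    show "m (UNIV \<times> A) = measure \<nu> A" if "A \<in> sets borel" for A
      by (rule uniq[OF m tendsto_mono[OF G(2) right[OF that]]])
  qed
  then obtain \<Delta> where \<Delta>: "\<Delta> \<in> couplings \<mu> \<nu>"
    and rect: "\<And>A B. A \<in> sets borel \<Longrightarrow> B \<in> sets borel \<Longrightarrow> measure \<Delta> (A \<times> B) = m (A \<times> B)"
    and op: "\<And>U. open U \<Longrightarrow> measure \<Delta> U \<le> m U" by blast
  note d = couplingsD[OF \<Delta>]
  interpret \<Delta>: prob_space \<Delta> by (rule d(1))
  have "measure \<Delta> (A \<times> B) = 0"
    if "A \<in> sets borel" "B \<in> sets borel" "\<forall>\<^sub>F i in F. measure (\<Gamma> i) (A \<times> B) = 0" for A B
  proof -
    have "m (A \<times> B) = 0"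
      using that(3) G(2) by (intro uniq[OF m] tendsto_eventually) (auto simp: le_filter_def)
    then show ?thesis using rect that by simp
  qed
  moreover have lim: "(\<integral>\<^sup>+p. ennreal (c p) \<partial>\<Delta>) \<le> K"
    if c: "lsc c" "\<And>p. 0 \<le> c p" and K: "\<forall>\<^sub>F i in F. (\<integral>\<^sup>+p. ennreal (c p) \<partial>\<Gamma> i) \<le> K" for c K
  proof (cases "K = \<top>")
    case False
    then obtain k where k: "K = ennreal k" "0 \<le> k" by (cases K) auto
    have cb: "c \<in> borel_measurable M" if "sets M = sets borel" for M
      using lsc_borel[OF c(1)] by (subst measurable_cong_sets[OF that refl])
    \<comment> \<open>Multiplying the cost by \<open>n\<close> turns the error \<open>1\<close> of the level sets into \<open>1 / n\<close>.\<close>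
    have n: "(\<integral>\<^sup>+p. ennreal (c p) \<partial>\<Delta>) \<le> ennreal (1 / real n + k)" if "0 < n" for n :: nat
    proof -
      have lv: "open {p. real (Suc j) < real n * c p}" for j
      proof -
        have "{p. real (Suc j) < real n * c p} = {p. real (Suc j) / real n < c p}"
          using that by (auto simp: field_simps)
        then show ?thesis using c(1) unfolding lsc_def by auto
      qed
      have "(\<integral>\<^sup>+p. ennreal (real n * c p) \<partial>\<Delta>) \<le> 1 + ennreal (n * k)"
      proof (rule nn_integral_le_level_sets)
        show "prob_space \<Delta>" by (rule d)
        show "(\<lambda>p. real n * c p) \<in> borel_measurable \<Delta>" using cb[OF d(2)] by measurable
        show "0 \<le> real n * c p" for p using c by simp
        fix J
        have "(\<Sum>j<J. measure \<Delta> {p. real (Suc j) < real n * c p})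
            \<le> (\<Sum>j<J. m {p. real (Suc j) < real n * c p})"
          by (intro sum_mono op lv)
        also have "\<dots> \<le> n * k"
        proof (rule tendsto_upperbound[OF tendsto_sum[OF m] _ G(1)])
          have "\<forall>\<^sub>F i in G. (\<integral>\<^sup>+p. ennreal (c p) \<partial>\<Gamma> i) \<le> K" using K G(2) by (auto simp: le_filter_def)
          then show "\<forall>\<^sub>F i in G. (\<Sum>j<J. measure (\<Gamma> i) {p. real (Suc j) < real n * c p}) \<le> n * k"
          proof (rule eventually_mono)
            fix i assume i: "(\<integral>\<^sup>+p. ennreal (c p) \<partial>\<Gamma> i) \<le> K"
            have "ennreal (\<Sum>j<J. measure (\<Gamma> i) {p\<in>space (\<Gamma> i). real (Suc j) < real n * c p})
                \<le> (\<integral>\<^sup>+p. ennreal (real n * c p) \<partial>\<Gamma> i)"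
              using c cb[OF s] by (intro nn_integral_level_sets_le P) auto
            also have "\<dots> = ennreal n * (\<integral>\<^sup>+p. ennreal (c p) \<partial>\<Gamma> i)"
              using c cb[OF s] by (simp add: ennreal_mult nn_integral_cmult)
            also have "\<dots> \<le> ennreal n * K" by (intro mult_left_mono i) auto
            also have "\<dots> = ennreal (n * k)" using k by (simp add: ennreal_mult)
            finally show "(\<Sum>j<J. measure (\<Gamma> i) {p. real (Suc j) < real n * c p}) \<le> n * k"
              using k by (simp add: sp ennreal_le_iff)
          qed
        qed
        finally show "ennreal (\<Sum>j<J. measure \<Delta> {p\<in>space \<Delta>. real (Suc j) < real n * c p}) \<le> ennreal (n * k)"
          using d(3) by (intro ennreal_leI) simp
      qed
      then have "ennreal n * (\<integral>\<^sup>+p. ennreal (c p) \<partial>\<Delta>) \<le> 1 + ennreal (n * k)"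
        using c cb[OF d(2)] by (simp add: ennreal_mult nn_integral_cmult)
      also have "\<dots> = ennreal n * ennreal (1 / n + k)"
        using that k by (simp add: ennreal_mult[symmetric] ennreal_plus[symmetric] distrib_left del: ennreal_plus flip: ennreal_1)
      finally show ?thesis using that by (subst (asm) ennreal_mult_le_mult_iff) auto
    qed
    have "(\<lambda>n. ennreal (1 / real n + k)) \<longlonglongrightarrow> ennreal (0 + k)"
      by (intro tendsto_ennrealI tendsto_add lim_1_over_n tendsto_const)
    then show ?thesis unfolding k(1)
      by (intro tendsto_lowerbound[of "\<lambda>n. ennreal (1 / real n + k)" _ sequentially])
         (use n in \<open>auto intro!: eventually_sequentiallyI[of 1]\<close>)
  qed simp
  moreover have "(\<integral>\<^sup>+p. ennreal (c p) \<partial>\<Delta>) \<le> K"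
    if "lsc c" "\<forall>p. 0 \<le> c p" "\<forall>e>0. \<forall>\<^sub>F i in F. (\<integral>\<^sup>+p. ennreal (c p) \<partial>\<Gamma> i) \<le> K + ennreal e" for c K
    by (rule ennreal_le_epsilon) (use that in \<open>auto intro: lim\<close>)
  ultimately show ?thesis using \<Delta> by blast
qed

section \<open>Gluing couplings\<close>

lemma measure_partition:
  assumes "prob_space M" "finite J" "\<And>x. x \<in> space M \<Longrightarrow> \<tau> x \<in> J"
    "\<And>I. I \<in> J \<Longrightarrow> {x \<in> space M. \<tau> x = I} \<in> sets M" "A \<in> sets M"
  shows "measure M A = (\<Sum>I\<in>J. measure M (A \<inter> {x\<in>space M. \<tau> x = I}))"
proof -
  interpret prob_space M by fact
  have "measure M (\<Union>I\<in>J. A \<inter> {x\<in>space M. \<tau> x = I}) = (\<Sum>I\<in>J. measure M (A \<inter> {x\<in>space M. \<tau> x = I}))"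
    using assms by (intro finite_measure_finite_Union) (auto simp: disjoint_family_on_def)
  moreover have "(\<Union>I\<in>J. A \<inter> {x\<in>space M. \<tau> x = I}) = A"
    using assms(3) sets.sets_into_space[OF assms(5)] by auto
  ultimately show ?thesis by simp
qed

lemma separating_opens:
  obtains U :: "nat \<Rightarrow> 'a::{second_countable_topology, t2_space} set"
  where "\<And>k. open (U k)" "\<And>x y. x \<noteq> y \<Longrightarrow> \<exists>k. x \<in> U k \<and> y \<notin> U k"
proof -
  obtain B :: "'a set set" where B: "countable B" "topological_basis B"
    using ex_countable_basis by blast
  show ?thesis
  proof (rule that[of "from_nat_into (insert UNIV B)"])
    show "open (from_nat_into (insert UNIV B) k)" for k
      using from_nat_into[of "insert UNIV B" k] topological_basis_open[OF B(2)] by auto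
    fix x y :: 'a assume "x \<noteq> y"
    then obtain V where "open V" "x \<in> V" "y \<notin> V" using t1_space by blast
    then obtain W where "W \<in> B" "x \<in> W" "W \<subseteq> V" using topological_basisE[OF B(2)] by metis
    then have "W \<in> range (from_nat_into (insert UNIV B))" "x \<in> W \<and> y \<notin> W"
      using B(1) \<open>y \<notin> V\<close> by (auto simp: range_from_nat_into)
    then show "\<exists>k. x \<in> from_nat_into (insert UNIV B) k \<and> y \<notin> from_nat_into (insert UNIV B) k"
      by auto
  qed
qed

text \<open>
  If the middle variable is only observed through a map \<open>\<tau>\<close> with finitely many values, gluing is explicit:
  the two pairs are made independent given that the observed values agree. The middle variables \<open>w\<close>, \<open>w'\<close>
  of the two couplings then differ in general, but \<open>\<tau> w = \<tau> w'\<close> almost surely.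
\<close>

lemma glue_along_partition:
  fixes \<Gamma>1 \<Gamma>2 :: "('a::{second_countable_topology, complete_space} \<times> 'a) measure"
    and \<tau> :: "'a \<Rightarrow> 'j"
  assumes \<Gamma>1: "\<Gamma>1 \<in> couplings \<mu> \<kappa>" and \<Gamma>2: "\<Gamma>2 \<in> couplings \<kappa> \<nu>"
    and J: "finite J" "\<And>w. \<tau> w \<in> J" "\<And>I. {w. \<tau> w = I} \<in> sets borel"
  shows "\<exists>\<Delta>\<in>couplings \<Gamma>1 \<Gamma>2. \<forall>A B. A \<in> sets borel \<longrightarrow> B \<in> sets borel \<longrightarrow> \<tau> ` A \<inter> \<tau> ` B = {} \<longrightarrow>
     measure \<Delta> ((UNIV \<times> A) \<times> (B \<times> UNIV)) = 0"
proof -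
  note c1 = couplingsD[OF \<Gamma>1] and c2 = couplingsD[OF \<Gamma>2]
  interpret \<Gamma>1: prob_space \<Gamma>1 by (rule c1)
  interpret \<Gamma>2: prob_space \<Gamma>2 by (rule c2)
  interpret pair_prob_space \<Gamma>1 \<Gamma>2 ..
  have sP: "sets (\<Gamma>1 \<Otimes>\<^sub>M \<Gamma>2) = sets borel"
    unfolding sets_pair_measure_cong[OF c1(2) c2(2)] borel_prod ..
  define S where "S I = {p :: 'a \<times> 'a. \<tau> (snd p) = I}" for I
  define T where "T I = {p :: 'a \<times> 'a. \<tau> (fst p) = I}" for I
  define q where "q I = measure \<kappa> {w. \<tau> w = I}" for I
  have ST: "S I = UNIV \<times> {w. \<tau> w = I}" "T I = {w. \<tau> w = I} \<times> UNIV" for I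
    by (auto simp: S_def T_def)
  have Sb[measurable]: "S I \<in> sets borel" and Tb[measurable]: "T I \<in> sets borel" for I
    unfolding ST using J(3) by (auto intro!: sets_borel_Times)
  have SP: "S I \<times> T I \<in> sets (\<Gamma>1 \<Otimes>\<^sub>M \<Gamma>2)" for I using c1 c2 by auto
  have qS: "measure \<Gamma>1 (S I) = q I" and qT: "measure \<Gamma>2 (T I) = q I" for I
    unfolding ST q_def using coupling_marginals(2)[OF \<Gamma>1 J(3)] coupling_marginals(1)[OF \<Gamma>2 J(3)] by auto
  have q0: "0 \<le> q I" for I by (simp add: q_def)
  \<comment> \<open>Cells with \<open>q I = 0\<close> get the factor \<open>1 / 0 = 0\<close>; they are null sets for both couplings.\<close>
  define d where "d p = (\<Sum>I\<in>J. ennreal (1 / q I) * indicator (S I \<times> T I) p)" for p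
  have dm: "d \<in> borel_measurable (\<Gamma>1 \<Otimes>\<^sub>M \<Gamma>2)" unfolding d_def using SP by measurable
  define \<Delta> where "\<Delta> = density (\<Gamma>1 \<Otimes>\<^sub>M \<Gamma>2) d"
  have s\<Delta>: "sets \<Delta> = sets borel" "space \<Delta> = UNIV"
    using sP c1 c2 by (simp_all add: \<Delta>_def space_pair_measure)
  have e\<Delta>: "emeasure \<Delta> (A \<times> B) = ennreal (\<Sum>I\<in>J. measure \<Gamma>1 (A \<inter> S I) * measure \<Gamma>2 (B \<inter> T I) / q I)"
    if [measurable]: "A \<in> sets borel" "B \<in> sets borel" for A B
  proof -
    have AB: "A \<times> B \<in> sets (\<Gamma>1 \<Otimes>\<^sub>M \<Gamma>2)" using c1 c2 by auto
    have "emeasure \<Delta> (A \<times> B) = (\<integral>\<^sup>+p. d p * indicator (A \<times> B) p \<partial>(\<Gamma>1 \<Otimes>\<^sub>M \<Gamma>2))"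
      unfolding \<Delta>_def by (rule emeasure_density[OF dm AB])
    also have "\<dots> = (\<integral>\<^sup>+p. (\<Sum>I\<in>J. ennreal (1 / q I) * indicator ((A \<inter> S I) \<times> (B \<inter> T I)) p) \<partial>(\<Gamma>1 \<Otimes>\<^sub>M \<Gamma>2))"
      unfolding d_def sum_distrib_right
      by (intro nn_integral_cong sum.cong refl) (auto simp: indicator_def)
    also have "\<dots> = (\<Sum>I\<in>J. ennreal (1 / q I) * emeasure (\<Gamma>1 \<Otimes>\<^sub>M \<Gamma>2) ((A \<inter> S I) \<times> (B \<inter> T I)))"
      using c1 c2 by (subst nn_integral_sum) (auto simp: nn_integral_cmult_indicator)
    also have "\<dots> = (\<Sum>I\<in>J. ennreal (measure \<Gamma>1 (A \<inter> S I) * measure \<Gamma>2 (B \<inter> T I) / q I))"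
      using c1 c2 q0
      by (intro sum.cong refl)
         (simp add: \<Gamma>2.emeasure_pair_measure_Times \<Gamma>1.emeasure_eq_measure \<Gamma>2.emeasure_eq_measure
           ennreal_mult[symmetric] mult_ac divide_inverse)
    also have "\<dots> = ennreal (\<Sum>I\<in>J. measure \<Gamma>1 (A \<inter> S I) * measure \<Gamma>2 (B \<inter> T I) / q I)"
      using q0 by (intro sum_ennreal) auto
    finally show ?thesis .
  qed
  have p1: "measure \<Gamma>1 A = (\<Sum>I\<in>J. measure \<Gamma>1 (A \<inter> S I))" if "A \<in> sets borel" for A
    using measure_partition[OF c1(1) J(1), of "\<lambda>p. \<tau> (snd p)" A] J(2) Sb that c1
    by (simp add: S_def)
  have p2: "measure \<Gamma>2 A = (\<Sum>I\<in>J. measure \<Gamma>2 (A \<inter> T I))" if "A \<in> sets borel" for A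
    using measure_partition[OF c2(1) J(1), of "\<lambda>p. \<tau> (fst p)" A] J(2) Tb that c2
    by (simp add: T_def)
  have left: "emeasure \<Delta> (A \<times> UNIV) = emeasure \<Gamma>1 A" if A: "A \<in> sets borel" for A
  proof -
    have "measure \<Gamma>1 (A \<inter> S I) * measure \<Gamma>2 (UNIV \<inter> T I) / q I = measure \<Gamma>1 (A \<inter> S I)" for I
    proof (cases "q I = 0")
      case True
      have "measure \<Gamma>1 (A \<inter> S I) \<le> q I" unfolding qS[symmetric]
        using A c1 by (intro \<Gamma>1.finite_measure_mono) auto
      then show ?thesis using True by (simp add: measure_le_0_iff)
    qed (simp add: qT)
    then show ?thesis using e\<Delta>[OF A, of UNIV] p1[OF A] \<Gamma>1.emeasure_eq_measure by simp
  qed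
  have right: "emeasure \<Delta> (UNIV \<times> A) = emeasure \<Gamma>2 A" if A: "A \<in> sets borel" for A
  proof -
    have "measure \<Gamma>1 (UNIV \<inter> S I) * measure \<Gamma>2 (A \<inter> T I) / q I = measure \<Gamma>2 (A \<inter> T I)" for I
    proof (cases "q I = 0")
      case True
      have "measure \<Gamma>2 (A \<inter> T I) \<le> q I" unfolding qT[symmetric]
        using A c2 by (intro \<Gamma>2.finite_measure_mono) auto
      then show ?thesis using True by (simp add: measure_le_0_iff)
    qed (simp add: qS)
    then show ?thesis using e\<Delta>[OF _ A, of UNIV] p2[OF A] \<Gamma>2.emeasure_eq_measure by simp
  qed
  have "prob_space \<Delta>"
    by (rule prob_spaceI) (use left[of UNIV] c1 s\<Delta> \<Gamma>1.emeasure_space_1 in auto)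
  moreover have "distr \<Delta> borel fst = \<Gamma>1"
  proof (rule measure_eqI)
    show "sets (distr \<Delta> borel fst) = sets \<Gamma>1" using c1 by simp
    fix A assume "A \<in> sets (distr \<Delta> borel fst)"
    moreover have "fst -` A \<inter> space \<Delta> = A \<times> UNIV" using s\<Delta> by auto
    ultimately show "emeasure (distr \<Delta> borel fst) A = emeasure \<Gamma>1 A"
      using measurable_fst_snd_borel[OF s\<Delta>(1)] left by (simp add: emeasure_distr)
  qed
  moreover have "distr \<Delta> borel snd = \<Gamma>2"
  proof (rule measure_eqI)
    show "sets (distr \<Delta> borel snd) = sets \<Gamma>2" using c2 by simp
    fix A assume "A \<in> sets (distr \<Delta> borel snd)"
    moreover have "snd -` A \<inter> space \<Delta> = UNIV \<times> A" using s\<Delta> by auto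
    ultimately show "emeasure (distr \<Delta> borel snd) A = emeasure \<Gamma>2 A"
      using measurable_fst_snd_borel[OF s\<Delta>(1)] right by (simp add: emeasure_distr)
  qed
  ultimately have "\<Delta> \<in> couplings \<Gamma>1 \<Gamma>2"
    using s\<Delta> by (simp add: couplings_def Pr_iff)
  moreover have "measure \<Delta> ((UNIV \<times> A) \<times> (B \<times> UNIV)) = 0"
    if AB: "A \<in> sets borel" "B \<in> sets borel" "\<tau> ` A \<inter> \<tau> ` B = {}" for A B
  proof -
    have "(UNIV \<times> A) \<inter> S I = {} \<or> (B \<times> UNIV) \<inter> T I = {}" for I
      using AB(3) unfolding S_def T_def by auto
    then have z: "measure \<Gamma>1 ((UNIV \<times> A) \<inter> S I) * measure \<Gamma>2 ((B \<times> UNIV) \<inter> T I) / q I = 0" for I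
      by (metis div_0 measure_empty mult_eq_0_iff)
    have "emeasure \<Delta> ((UNIV \<times> A) \<times> (B \<times> UNIV)) =
        ennreal (\<Sum>I\<in>J. measure \<Gamma>1 ((UNIV \<times> A) \<inter> S I) * measure \<Gamma>2 ((B \<times> UNIV) \<inter> T I) / q I)"
      by (intro e\<Delta> sets_borel_Times) (use AB in auto)
    then show ?thesis unfolding z by (simp add: measure_def)
  qed
  ultimately show ?thesis by blast
qed

text \<open>
  With the observations \<open>\<tau> n\<close> recording membership in the first \<open>n\<close> sets of a countable family that
  separates points, the two middle variables agree in the limit.
\<close>

lemma glue_couplings:
  fixes \<Gamma>1 \<Gamma>2 :: "('a::{second_countable_topology, complete_space} \<times> 'a) measure"
  assumes \<Gamma>1: "\<Gamma>1 \<in> couplings \<mu> \<kappa>" and \<Gamma>2: "\<Gamma>2 \<in> couplings \<kappa> \<nu>"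
  shows "\<exists>\<Delta>\<in>couplings \<Gamma>1 \<Gamma>2. AE (p, p') in \<Delta>. snd p = fst p'"
proof -
  obtain U :: "nat \<Rightarrow> 'a set" where U: "\<And>k. open (U k)" "\<And>x y. x \<noteq> y \<Longrightarrow> \<exists>k. x \<in> U k \<and> y \<notin> U k"
    using separating_opens by blast
  define \<tau> where "\<tau> n w = {k. k < n \<and> w \<in> U k}" for n :: nat and w
  have cell: "{w. \<tau> n w = I} \<in> sets borel" for n I
  proof (cases "I \<subseteq> {..<n}")
    case True
    then have "{w. \<tau> n w = I} = (\<Inter>k\<in>{..<n}. if k \<in> I then U k else - U k)"
      unfolding \<tau>_def by (auto split: if_splits)
    moreover have "(\<Inter>k\<in>{..<n}. if k \<in> I then U k else - U k) \<in> sets borel"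
    proof (cases "n = 0")
      case False
      then show ?thesis by (intro sets.finite_INT) (use U in auto)
    qed simp
    ultimately show ?thesis by simp
  next
    case False
    then have "{w. \<tau> n w = I} = {}" by (auto simp: \<tau>_def)
    then show ?thesis by simp
  qed
  have "\<exists>\<Delta>. \<forall>n. \<Delta> n \<in> couplings \<Gamma>1 \<Gamma>2 \<and> (\<forall>A B. A \<in> sets borel \<longrightarrow> B \<in> sets borel \<longrightarrow>
      \<tau> n ` A \<inter> \<tau> n ` B = {} \<longrightarrow> measure (\<Delta> n) ((UNIV \<times> A) \<times> (B \<times> UNIV)) = 0)"
  proof (rule choice, rule allI)
    fix n
    show "\<exists>\<Delta>. \<Delta> \<in> couplings \<Gamma>1 \<Gamma>2 \<and> (\<forall>A B. A \<in> sets borel \<longrightarrow> B \<in> sets borel \<longrightarrow>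
      \<tau> n ` A \<inter> \<tau> n ` B = {} \<longrightarrow> measure \<Delta> ((UNIV \<times> A) \<times> (B \<times> UNIV)) = 0)"
      using glue_along_partition[OF \<Gamma>1 \<Gamma>2, of "Pow {..<n}" "\<tau> n"] cell by (auto simp: \<tau>_def)
  qed
  then obtain \<Delta> where D: "\<forall>n. \<Delta> n \<in> couplings \<Gamma>1 \<Gamma>2 \<and> (\<forall>A B. A \<in> sets borel \<longrightarrow> B \<in> sets borel \<longrightarrow>
      \<tau> n ` A \<inter> \<tau> n ` B = {} \<longrightarrow> measure (\<Delta> n) ((UNIV \<times> A) \<times> (B \<times> UNIV)) = 0)"
    by (rule exE)
  have \<Delta>: "\<Delta> n \<in> couplings \<Gamma>1 \<Gamma>2" for n
    using D by simp
  have null: "measure (\<Delta> n) ((UNIV \<times> A) \<times> (B \<times> UNIV)) = 0"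
    if "A \<in> sets borel" "B \<in> sets borel" "\<tau> n ` A \<inter> \<tau> n ` B = {}" for n A B
    by (rule D[THEN spec, THEN conjunct2, rule_format, OF that])
  have pr: "\<Delta> n \<in> Pr" "\<Gamma>1 \<in> Pr" "\<Gamma>2 \<in> Pr" for n
    using couplingsD[OF \<Delta>] couplingsD[OF \<Gamma>1] couplingsD[OF \<Gamma>2] by (auto simp: Pr_iff)
  have cluster: "\<exists>\<Xi>\<in>couplings \<Gamma>1 \<Gamma>2. \<forall>A B. A \<in> sets borel \<longrightarrow> B \<in> sets borel \<longrightarrow>
       (\<forall>\<^sub>F n in sequentially. measure (\<Delta> n) (A \<times> B) = 0) \<longrightarrow> measure \<Xi> (A \<times> B) = 0"
    by (rule bexE[OF couplings_cluster[of sequentially \<Delta> \<Gamma>1 \<Gamma>2]])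
       (auto simp: pr coupling_marginals[OF \<Delta>])
  obtain \<Xi> where \<Xi>: "\<Xi> \<in> couplings \<Gamma>1 \<Gamma>2"
    and lim': "\<forall>A B. A \<in> sets borel \<longrightarrow> B \<in> sets borel \<longrightarrow>
       (\<forall>\<^sub>F n in sequentially. measure (\<Delta> n) (A \<times> B) = 0) \<longrightarrow> measure \<Xi> (A \<times> B) = 0"
    by (rule bexE[OF cluster])
  note lim = lim'[rule_format]
  note x = couplingsD[OF \<Xi>]
  interpret \<Xi>: prob_space \<Xi> by (rule x)
  have "AE p in \<Xi>. p \<notin> (UNIV \<times> U k) \<times> ((- U k) \<times> UNIV)" for k
  proof -
    have "\<tau> n ` U k \<inter> \<tau> n ` (- U k) = {}" if "k < n" for n
      using that by (auto simp: \<tau>_def)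
    then have "measure \<Xi> ((UNIV \<times> U k) \<times> ((- U k) \<times> UNIV)) = 0"
      using U(1)[of k] by (intro lim sets_borel_Times eventually_sequentiallyI[of "Suc k"] null) auto
    moreover have "(UNIV \<times> U k) \<times> ((- U k) \<times> UNIV) \<in> sets \<Xi>"
      unfolding x(2) using U(1)[of k] by (intro sets_borel_Times) auto
    ultimately show ?thesis
      by (intro AE_I[OF _ _ , of _ _ "(UNIV \<times> U k) \<times> ((- U k) \<times> UNIV)"]) (auto simp: \<Xi>.emeasure_eq_measure)
  qed
  then have "AE p in \<Xi>. \<forall>k. p \<notin> (UNIV \<times> U k) \<times> ((- U k) \<times> UNIV)" by (simp add: AE_all_countable)
  then have "AE (p, p') in \<Xi>. snd p = fst p'"
  proof (rule AE_mp, intro AE_I2 impI)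
    fix z assume "\<forall>k. z \<notin> (UNIV \<times> U k) \<times> ((- U k) \<times> UNIV)"
    then show "case z of (p, p') \<Rightarrow> snd p = fst p'"
      using U(2)[of "snd (fst z)" "fst (snd z)"] by (cases z) (auto simp: mem_Times_iff)
  qed
  then show ?thesis using \<Xi> by blast
qed

section \<open>The triangle inequality\<close>

lemma wasserstein_near_optimal:
  assumes "wasserstein c \<mu> \<nu> < \<top>" "0 < (e::real)"
  obtains \<Gamma> where "\<Gamma> \<in> couplings \<mu> \<nu>" "(\<integral>\<^sup>+p. ennreal (case_prod c p) \<partial>\<Gamma>) \<le> wasserstein c \<mu> \<nu> + ennreal e"
proof -
  have "wasserstein c \<mu> \<nu> < wasserstein c \<mu> \<nu> + ennreal e"
    using assms by (cases "wasserstein c \<mu> \<nu>") (auto simp: ennreal_plus[symmetric] ennreal_less_iff simp del: ennreal_plus)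
  then obtain \<Gamma> where "\<Gamma> \<in> couplings \<mu> \<nu>"
    "(\<integral>\<^sup>+(u, v). ennreal (c u v) \<partial>\<Gamma>) < wasserstein c \<mu> \<nu> + ennreal e"
    by (subst (asm) (1) wasserstein_def) (auto simp: INF_less_iff)
  then show ?thesis by (intro that[of \<Gamma>]) (auto simp: case_prod_beta' less_imp_le)
qed

lemma wasserstein_le:
  "\<Gamma> \<in> couplings \<mu> \<nu> \<Longrightarrow> wasserstein c \<mu> \<nu> \<le> (\<integral>\<^sup>+p. ennreal (case_prod c p) \<partial>\<Gamma>)"
  unfolding wasserstein_def by (rule INF_lower2) (auto simp: case_prod_beta')

lemma wasserstein_triangle:
  fixes c c1 c2 :: "'a::{second_countable_topology, complete_space} \<Rightarrow> 'a \<Rightarrow> real"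
  assumes m: "case_prod c \<in> borel_measurable borel" "case_prod c1 \<in> borel_measurable borel"
      "case_prod c2 \<in> borel_measurable borel"
    and nn: "\<And>u v. 0 \<le> c1 u v" "\<And>u v. 0 \<le> c2 u v"
    and tri: "\<And>u v w. c u v \<le> c1 u w + c2 w v"
  shows "wasserstein c \<mu> \<nu> \<le> wasserstein c1 \<mu> \<kappa> + wasserstein c2 \<kappa> \<nu>"
proof (cases "wasserstein c1 \<mu> \<kappa> < \<top> \<and> wasserstein c2 \<kappa> \<nu> < \<top>")
  case True
  show ?thesis
  proof (rule ennreal_le_epsilon)
    fix e :: real assume "0 < e"
    then have e: "0 < e / 2" by simp
    obtain \<Gamma>1 where \<Gamma>1: "\<Gamma>1 \<in> couplings \<mu> \<kappa>"
      "(\<integral>\<^sup>+p. ennreal (case_prod c1 p) \<partial>\<Gamma>1) \<le> wasserstein c1 \<mu> \<kappa> + ennreal (e/2)"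
      by (rule wasserstein_near_optimal[OF conjunct1[OF True] e])
    obtain \<Gamma>2 where \<Gamma>2: "\<Gamma>2 \<in> couplings \<kappa> \<nu>"
      "(\<integral>\<^sup>+p. ennreal (case_prod c2 p) \<partial>\<Gamma>2) \<le> wasserstein c2 \<kappa> \<nu> + ennreal (e/2)"
      by (rule wasserstein_near_optimal[OF conjunct2[OF True] e])
    obtain \<Delta> where \<Delta>: "\<Delta> \<in> couplings \<Gamma>1 \<Gamma>2" "AE (p, p') in \<Delta>. snd p = fst p'"
      using glue_couplings[OF \<Gamma>1(1) \<Gamma>2(1)] by blast
    note d = couplingsD[OF \<Delta>(1)] and d1 = couplingsD[OF \<Gamma>1(1)] and d2 = couplingsD[OF \<Gamma>2(1)]
    note fs = measurable_fst_snd_borel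
    have f: "fst \<in> \<Delta> \<rightarrow>\<^sub>M borel" "snd \<in> \<Delta> \<rightarrow>\<^sub>M borel" by (simp_all add: fs d(2))
    have b: "fst \<in> (borel :: ('a \<times> 'a) measure) \<rightarrow>\<^sub>M borel" "snd \<in> (borel :: ('a \<times> 'a) measure) \<rightarrow>\<^sub>M borel"
      by (simp_all add: fs)
    have out: "(\<lambda>z. (fst (fst z), snd (snd z))) \<in> \<Delta> \<rightarrow>\<^sub>M borel"
      unfolding borel_prod[symmetric]
      by (intro measurable_Pair measurable_compose[OF f(1) b(1)] measurable_compose[OF f(2) b(2)])
    define \<Gamma> where "\<Gamma> = distr \<Delta> borel (\<lambda>z. (fst (fst z), snd (snd z)))"
    have "distr \<Gamma> borel fst = distr (distr \<Delta> borel fst) borel fst"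
      unfolding \<Gamma>_def by (simp add: distr_distr[OF b(1) out] distr_distr[OF b(1) f(1)] comp_def)
    moreover have "distr \<Gamma> borel snd = distr (distr \<Delta> borel snd) borel snd"
      unfolding \<Gamma>_def by (simp add: distr_distr[OF b(2) out] distr_distr[OF b(2) f(2)] comp_def)
    moreover have "prob_space \<Gamma>" unfolding \<Gamma>_def by (rule prob_space.prob_space_distr[OF d(1) out])
    ultimately have \<Gamma>: "\<Gamma> \<in> couplings \<mu> \<nu>"
      by (simp add: couplings_def Pr_iff d d1 d2) (simp add: \<Gamma>_def)
    have "wasserstein c \<mu> \<nu> \<le> (\<integral>\<^sup>+p. ennreal (case_prod c p) \<partial>\<Gamma>)" by (rule wasserstein_le[OF \<Gamma>])
    also have "\<dots> = (\<integral>\<^sup>+z. ennreal (c (fst (fst z)) (snd (snd z))) \<partial>\<Delta>)"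
      unfolding \<Gamma>_def using m(1) by (subst nn_integral_distr[OF out]) auto
    also have "\<dots> \<le> (\<integral>\<^sup>+z. ennreal (case_prod c1 (fst z)) + ennreal (case_prod c2 (snd z)) \<partial>\<Delta>)"
    proof (rule nn_integral_mono_AE, use \<Delta>(2) in eventually_elim)
      case (elim z)
      then have "c (fst (fst z)) (snd (snd z)) \<le> case_prod c1 (fst z) + case_prod c2 (snd z)"
        using tri[of "fst (fst z)" "snd (snd z)" "snd (fst z)"] by (auto simp: case_prod_beta')
      from ennreal_leI[OF this] show ?case
        using nn by (simp add: case_prod_beta')
    qed
    also have "\<dots> = (\<integral>\<^sup>+z. ennreal (case_prod c1 (fst z)) \<partial>\<Delta>) + (\<integral>\<^sup>+z. ennreal (case_prod c2 (snd z)) \<partial>\<Delta>)"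
      by (intro nn_integral_add measurable_compose[OF f(1)] measurable_compose[OF f(2)] measurable_compose[OF _ measurable_ennreal] m)
    also have "(\<integral>\<^sup>+z. ennreal (case_prod c1 (fst z)) \<partial>\<Delta>) = (\<integral>\<^sup>+p. ennreal (case_prod c1 p) \<partial>\<Gamma>1)"
      unfolding d(4)[symmetric] using m(2) by (subst nn_integral_distr[OF f(1)]) auto
    also have "(\<integral>\<^sup>+z. ennreal (case_prod c2 (snd z)) \<partial>\<Delta>) = (\<integral>\<^sup>+p. ennreal (case_prod c2 p) \<partial>\<Gamma>2)"
      unfolding d(5)[symmetric] using m(3) by (subst nn_integral_distr[OF f(2)]) auto
    also have "(\<integral>\<^sup>+p. ennreal (case_prod c1 p) \<partial>\<Gamma>1) + (\<integral>\<^sup>+p. ennreal (case_prod c2 p) \<partial>\<Gamma>2)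
       \<le> (wasserstein c1 \<mu> \<kappa> + ennreal (e/2)) + (wasserstein c2 \<kappa> \<nu> + ennreal (e/2))"
      by (rule add_mono[OF \<Gamma>1(2) \<Gamma>2(2)])
    also have "\<dots> = wasserstein c1 \<mu> \<kappa> + wasserstein c2 \<kappa> \<nu> + (ennreal (e/2) + ennreal (e/2))"
      by (simp add: ac_simps)
    also have "ennreal (e/2) + ennreal (e/2) = ennreal e"
      using e by (subst ennreal_plus[symmetric]) auto
    finally show "wasserstein c \<mu> \<nu> \<le> wasserstein c1 \<mu> \<kappa> + wasserstein c2 \<kappa> \<nu> + ennreal e" .
  qed
next
  case False
  then show ?thesis by (auto simp: not_less top_unique)
qed

section \<open>Transport cost between mixtures\<close>

lemma couplings_nonempty:
  fixes \<mu> \<nu> :: "'a::second_countable_topology measure"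
  assumes \<mu>: "\<mu> \<in> Pr" and \<nu>: "\<nu> \<in> Pr"
  shows "\<mu> \<Otimes>\<^sub>M \<nu> \<in> couplings \<mu> \<nu>"
proof -
  have s: "sets \<mu> = sets borel" "sets \<nu> = sets borel" and p: "prob_space \<mu>" "prob_space \<nu>"
    using \<mu> \<nu> by (auto simp: Pr_iff)
  interpret \<mu>: prob_space \<mu> by fact
  interpret \<nu>: prob_space \<nu> by fact
  interpret pair_prob_space \<mu> \<nu> ..
  have sP: "sets (\<mu> \<Otimes>\<^sub>M \<nu>) = sets borel"
    unfolding sets_pair_measure_cong[OF s] borel_prod ..
  have "distr (\<mu> \<Otimes>\<^sub>M \<nu>) borel fst = distr (\<mu> \<Otimes>\<^sub>M \<nu>) \<mu> fst"
    by (rule distr_cong) (simp_all add: s)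
  moreover have "distr (\<mu> \<Otimes>\<^sub>M \<nu>) borel snd = distr (\<mu> \<Otimes>\<^sub>M \<nu>) \<nu> snd"
    by (rule distr_cong) (simp_all add: s)
  moreover have "distr (\<mu> \<Otimes>\<^sub>M \<nu>) \<nu> snd = \<nu>"
  proof (rule measure_eqI)
    fix A assume "A \<in> sets (distr (\<mu> \<Otimes>\<^sub>M \<nu>) \<nu> snd)"
    moreover from this have "snd -` A \<inter> space (\<mu> \<Otimes>\<^sub>M \<nu>) = space \<mu> \<times> A"
      using sets.sets_into_space[of A \<nu>] by (auto simp: space_pair_measure)
    ultimately show "emeasure (distr (\<mu> \<Otimes>\<^sub>M \<nu>) \<nu> snd) A = emeasure \<nu> A"
      by (simp add: emeasure_distr \<nu>.emeasure_pair_measure_Times \<mu>.emeasure_space_1)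
  qed simp
  ultimately show ?thesis
    using \<nu>.distr_pair_fst[of \<mu>] sP P.prob_space_axioms by (simp add: couplings_def Pr_iff)
qed

text \<open>
  With representatives below the mean, the discretization in \<open>approximate_mixture\<close> does not increase the
  integral of \<open>F\<close>, even though \<open>F\<close> may be unbounded. If \<open>C\<close> is a null set, any point of \<open>C\<close> will do.
\<close>

lemma exists_below_mean:
  fixes F :: "'a \<Rightarrow> ennreal"
  assumes "finite_measure M" and F: "F \<in> borel_measurable M" and C: "C \<in> sets M" "C \<noteq> {}"
  shows "\<exists>v\<in>C. F v * emeasure M C \<le> (\<integral>\<^sup>+u. F u * indicator C u \<partial>M)"
proof (rule ccontr)
  interpret finite_measure M by fact
  let ?I = "\<integral>\<^sup>+u. F u * indicator C u \<partial>M"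
  assume "\<not> ?thesis"
  then have gt: "?I < F v * emeasure M C" if "v \<in> C" for v using that by (auto simp: not_le)
  obtain m where m: "emeasure M C = ennreal m" "0 < m"
  proof -
    obtain v where "v \<in> C" using C by auto
    from gt[OF this] have "emeasure M C \<noteq> 0" by auto
    then show ?thesis using that[of "measure M C"]
      by (simp add: emeasure_eq_measure measure_nonneg less_le)
  qed
  obtain w where "w \<in> C" using C(2) by auto
  then have fin: "?I < \<top>" by (rule order_less_le_trans[OF gt top_greatest])
  have "?I * emeasure M C = (\<integral>\<^sup>+u. ?I * indicator C u \<partial>M)"
    using C by (simp add: nn_integral_cmult_indicator)
  also have "\<dots> < (\<integral>\<^sup>+u. F u * emeasure M C * indicator C u \<partial>M)"
  proof (rule nn_integral_less)
    show "(\<lambda>u. ?I * indicator C u) \<in> borel_measurable M"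
      "(\<lambda>u. F u * emeasure M C * indicator C u) \<in> borel_measurable M"
      using F C(1) by (auto intro!: borel_measurable_times_ennreal)
    show "(\<integral>\<^sup>+u. ?I * indicator C u \<partial>M) \<noteq> \<infinity>"
      using C fin m by (simp add: nn_integral_cmult_indicator ennreal_mult_eq_top_iff)
    show "AE u in M. ?I * indicator C u \<le> F u * emeasure M C * indicator C u"
      using gt by (intro AE_I2) (auto simp: indicator_def less_imp_le)
    show "\<not> (AE u in M. F u * emeasure M C * indicator C u \<le> ?I * indicator C u)"
    proof
      assume "AE u in M. F u * emeasure M C * indicator C u \<le> ?I * indicator C u"
      then have "AE u in M. u \<notin> C"
        by eventually_elim (use gt in \<open>auto simp: indicator_def not_less[symmetric] split: if_splits\<close>)
      then have "emeasure M C = 0" using C(1) AE_iff_measurable[of C M "\<lambda>u. u \<notin> C"] sets.sets_into_space[OF C(1)]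
        by auto
      then show False using m by simp
    qed
  qed
  also have "\<dots> = (\<integral>\<^sup>+u. emeasure M C * (F u * indicator C u) \<partial>M)"
    by (simp add: mult_ac)
  also have "\<dots> = emeasure M C * ?I"
    using F C(1) by (intro nn_integral_cmult borel_measurable_times_ennreal borel_measurable_indicator)
  finally show False by (simp add: mult.commute)
qed

lemma measure_bind_Pr:
  fixes M :: "'c::topological_space measure" and P :: "'c \<Rightarrow> 'a::topological_space measure"
  assumes "M \<in> Pr" "P \<in> borel \<rightarrow>\<^sub>M prob_algebra borel" "A \<in> sets borel"
  shows "measure (M \<bind> P) A = (\<integral>u. measure (P u) A \<partial>M)"
proof -
  interpret prob_space M using assms by (simp add: Pr_iff)
  have "sets M = sets borel" using assms by (simp add: Pr_iff)
  then have "P \<in> M \<rightarrow>\<^sub>M subprob_algebra borel"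
    using measurable_prob_algebraD[OF assms(2)] by (simp cong: measurable_cong_sets)
  then show ?thesis using assms(3) by (rule measure_bind)
qed

lemma markov_kernel_Pr: "P \<in> borel \<rightarrow>\<^sub>M prob_algebra borel \<Longrightarrow> P u \<in> Pr"
  by (auto dest: measurable_space[of _ _ _ u])

lemma (in prob_space) integral_diff_le:
  fixes f g :: "'a \<Rightarrow> real"
  assumes m: "f \<in> borel_measurable M" "g \<in> borel_measurable M"
    and b: "\<And>u. \<bar>f u\<bar> \<le> 1" "\<And>u. \<bar>g u\<bar> \<le> 1" and e: "\<And>u. \<bar>f u - g u\<bar> \<le> e"
  shows "\<bar>(\<integral>u. f u \<partial>M) - (\<integral>u. g u \<partial>M)\<bar> \<le> e"
proof -
  have i: "integrable M f" "integrable M g"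
    using m b by (auto intro!: integrable_const_bound[of _ 1])
  have "\<bar>(\<integral>u. f u \<partial>M) - (\<integral>u. g u \<partial>M)\<bar> = \<bar>\<integral>u. f u - g u \<partial>M\<bar>" using i by simp
  also have "\<dots> \<le> (\<integral>u. \<bar>f u - g u\<bar> \<partial>M)" by (rule integral_abs_bound)
  also have "\<dots> \<le> (\<integral>u. e \<partial>M)" using i e by (intro integral_mono) auto
  also have "\<dots> = e" using prob_space by simp
  finally show ?thesis .
qed

text \<open>
  Mixing couplings of \<open>P u\<close> and \<open>Q u\<close> requires them to depend measurably on \<open>u\<close>. When only the sets in a finite
  \<open>S\<close> matter, up to an error \<open>e\<close>, finitely many couplings suffice: \<open>u\<close> is replaced by a representative of
  its cell, where a cell consists of the points whose values \<open>measure (P u) A\<close> and \<open>measure (Q u) A\<close>, for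
  \<open>A \<in> S\<close>, agree after rounding to multiples of \<open>e\<close>.
\<close>

lemma approximate_mixture:
  fixes P Q :: "'c::topological_space \<Rightarrow> 'a::{second_countable_topology, complete_space} measure"
  assumes M: "M \<in> Pr" and P: "P \<in> borel \<rightarrow>\<^sub>M prob_algebra borel" and Q: "Q \<in> borel \<rightarrow>\<^sub>M prob_algebra borel"
    and c: "lsc (case_prod c)" and F: "F \<in> borel_measurable borel"
    and W: "\<And>u. wasserstein c (P u) (Q u) \<le> F u"
    and S: "finite S" "S \<subseteq> sets borel" and e: "0 < (e :: real)"
  shows "\<exists>\<Gamma>\<in>Pr. (\<forall>A\<in>S. \<bar>measure \<Gamma> (A \<times> UNIV) - measure (M \<bind> P) A\<bar> \<le> e \<and>
        \<bar>measure \<Gamma> (UNIV \<times> A) - measure (M \<bind> Q) A\<bar> \<le> e) \<and>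
      (\<integral>\<^sup>+p. ennreal (case_prod c p) \<partial>\<Gamma>) \<le> (\<integral>\<^sup>+u. F u \<partial>M) + ennreal e"
proof -
  interpret M: prob_space M using M by (simp add: Pr_iff)
  have sM[measurable_cong]: "sets M = sets borel" using M by (simp add: Pr_iff)
  have spM: "space M = UNIV" using sets_eq_imp_space_eq[OF sM] by simp
  have PQ: "P u \<in> Pr" "Q u \<in> Pr" for u using P Q by (auto intro: markov_kernel_Pr)
  have PQprob: "prob_space (P u)" "prob_space (Q u)" for u using PQ by (auto simp: Pr_iff)
  have Pm: "(\<lambda>u. measure (P u) A) \<in> borel_measurable M" and Qm: "(\<lambda>u. measure (Q u) A) \<in> borel_measurable M"
    if A: "A \<in> sets borel" for A
    using measurable_compose[OF P measurable_measure_prob_algebra[OF A]]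
      measurable_compose[OF Q measurable_measure_prob_algebra[OF A]] sM
    by (auto cong: measurable_cong_sets)
  define r where "r u A = (\<lfloor>measure (P u) A / e\<rfloor>, \<lfloor>measure (Q u) A / e\<rfloor>)" for u A
  define \<kappa> where "\<kappa> u = restrict (r u) S" for u
  define J where "J = range \<kappa>"
  have "J \<subseteq> (PiE S (\<lambda>_. {0..\<lfloor>1/e\<rfloor>} \<times> {0..\<lfloor>1/e\<rfloor>}))"
  proof -
    have "measure (P u) A / e \<le> 1 / e" "measure (Q u) A / e \<le> 1 / e" for u A
      using e PQprob by (auto intro!: divide_right_mono prob_space.prob_le_1)
    then have "r u A \<in> {0..\<lfloor>1/e\<rfloor>} \<times> {0..\<lfloor>1/e\<rfloor>}" for u A
      using e unfolding r_def by (auto intro!: floor_mono)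
    then show ?thesis unfolding J_def \<kappa>_def by auto
  qed
  then have J: "finite J" by (rule finite_subset) (auto intro!: finite_PiE S)
  have cell: "{u. \<kappa> u = j} \<in> sets M" if "j \<in> J" for j
  proof -
    have "{u. \<kappa> u = j} = {u\<in>space M. \<forall>A\<in>S. \<lfloor>measure (P u) A / e\<rfloor> = fst (j A) \<and> \<lfloor>measure (Q u) A / e\<rfloor> = snd (j A)}"
    proof -
      have "j \<in> extensional S" using that unfolding J_def \<kappa>_def by auto
      then show ?thesis unfolding spM \<kappa>_def
        by (auto simp: r_def intro!: extensionalityI[of _ S])
    qed
    also have "\<dots> \<in> sets M"
    proof (rule sets.sets_Collect_finite_All)
      fix A assume "A \<in> S"
      then have [measurable]: "(\<lambda>u. measure (P u) A) \<in> borel_measurable M" "(\<lambda>u. measure (Q u) A) \<in> borel_measurable M"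
        using S Pm Qm by auto
      show "{u \<in> space M. \<lfloor>measure (P u) A / e\<rfloor> = fst (j A) \<and> \<lfloor>measure (Q u) A / e\<rfloor> = snd (j A)} \<in> sets M"
        by measurable
    qed (rule S)
    finally show ?thesis .
  qed
  have \<kappa>m: "\<kappa> \<in> M \<rightarrow>\<^sub>M count_space J"
    using J cell by (subst measurable_count_space_eq2) (auto simp: J_def spM vimage_def)
  have Fm[measurable]: "F \<in> borel_measurable M" using F by (simp cong: measurable_cong_sets add: sM)
  have "\<exists>v. \<forall>j\<in>J. \<kappa> (v j) = j \<and>
      F (v j) * emeasure M {u. \<kappa> u = j} \<le> (\<integral>\<^sup>+u. F u * indicator {u. \<kappa> u = j} u \<partial>M)"
  proof (rule bchoice, rule ballI)
    fix j assume "j \<in> J"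
    then show "\<exists>v. \<kappa> v = j \<and>
        F v * emeasure M {u. \<kappa> u = j} \<le> (\<integral>\<^sup>+u. F u * indicator {u. \<kappa> u = j} u \<partial>M)"
      using exists_below_mean[OF M.finite_measure_axioms Fm cell] by (auto simp: J_def)
  qed
  then obtain v where v': "\<forall>j\<in>J. \<kappa> (v j) = j \<and>
      F (v j) * emeasure M {u. \<kappa> u = j} \<le> (\<integral>\<^sup>+u. F u * indicator {u. \<kappa> u = j} u \<partial>M)"
    by (rule exE)
  have v: "\<kappa> (v j) = j"
    "F (v j) * emeasure M {u. \<kappa> u = j} \<le> (\<integral>\<^sup>+u. F u * indicator {u. \<kappa> u = j} u \<partial>M)" if "j \<in> J" for j
    using v' that by blast+
  have "\<exists>\<Gamma>\<in>couplings (P u) (Q u). (\<integral>\<^sup>+p. ennreal (case_prod c p) \<partial>\<Gamma>) \<le> F u + ennreal e" for u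
  proof (cases "wasserstein c (P u) (Q u) < \<top>")
    case True
    then obtain \<Gamma> where \<Gamma>: "\<Gamma> \<in> couplings (P u) (Q u)"
      "(\<integral>\<^sup>+p. ennreal (case_prod c p) \<partial>\<Gamma>) \<le> wasserstein c (P u) (Q u) + ennreal e"
      using wasserstein_near_optimal[OF _ e] by blast
    note \<Gamma>(2)
    also have "wasserstein c (P u) (Q u) + ennreal e \<le> F u + ennreal e" by (intro add_mono W order_refl)
    finally show ?thesis using \<Gamma>(1) by blast
  next
    case False
    then have "F u = \<top>" using W[of u] by (simp add: top_unique not_less)
    then show ?thesis using couplings_nonempty[OF PQ] by (auto simp: top_unique)
  qed
  then have "\<forall>u. \<exists>\<Gamma>. \<Gamma> \<in> couplings (P u) (Q u) \<and> (\<integral>\<^sup>+p. ennreal (case_prod c p) \<partial>\<Gamma>) \<le> F u + ennreal e"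
    by blast
  from choice[OF this] obtain H where
    H': "\<forall>u. H u \<in> couplings (P u) (Q u) \<and> (\<integral>\<^sup>+p. ennreal (case_prod c p) \<partial>H u) \<le> F u + ennreal e"
    by (rule exE)
  have H: "H u \<in> couplings (P u) (Q u)" "(\<integral>\<^sup>+p. ennreal (case_prod c p) \<partial>H u) \<le> F u + ennreal e" for u
    using H' by simp_all
  define K where "K u = H (v (\<kappa> u))" for u
  have HPr: "H u \<in> Pr" for u using couplingsD[OF H(1)] by (simp add: Pr_iff)
  have K: "K \<in> M \<rightarrow>\<^sub>M prob_algebra borel"
    unfolding K_def by (rule measurable_compose[OF \<kappa>m]) (simp add: measurable_count_space_eq1 HPr)
  then have Kb: "K \<in> borel \<rightarrow>\<^sub>M prob_algebra borel" by (simp cong: measurable_cong_sets add: sM)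
  have close: "\<bar>measure (P (v (\<kappa> u))) A - measure (P u) A\<bar> \<le> e \<and> \<bar>measure (Q (v (\<kappa> u))) A - measure (Q u) A\<bar> \<le> e"
    if "A \<in> S" for u A
  proof -
    have "\<kappa> (v (\<kappa> u)) = \<kappa> u" by (rule v) (simp add: J_def)
    then have "r (v (\<kappa> u)) A = r u A" using that unfolding \<kappa>_def by (metis restrict_apply')
    moreover have "\<bar>x - y\<bar> \<le> e" if "\<lfloor>x / e\<rfloor> = \<lfloor>y / e\<rfloor>" for x y
    proof -
      have "\<bar>x / e - y / e\<bar> \<le> 1" using that by linarith
      then show ?thesis using e by (simp add: diff_divide_distrib[symmetric] divide_le_eq)
    qed
    ultimately show ?thesis unfolding r_def by auto
  qed
  define \<Gamma> where "\<Gamma> = M \<bind> K"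
  have \<Gamma>: "\<Gamma> \<in> Pr" unfolding \<Gamma>_def Pr_iff
    using prob_space_bind'[OF M Kb] sets_bind'[OF M Kb] by simp
  have le1: "measure N A \<le> 1" if "prob_space N" for N :: "'a measure" and A
    by (rule prob_space.prob_le_1[OF that])
  have Km: "(\<lambda>u. measure (K u) A) \<in> borel_measurable M" if "A \<in> sets borel" for A
    using measurable_compose[OF K measurable_measure_prob_algebra[OF that]] .
  have "\<bar>measure \<Gamma> (A \<times> UNIV) - measure (M \<bind> P) A\<bar> \<le> e \<and> \<bar>measure \<Gamma> (UNIV \<times> A) - measure (M \<bind> Q) A\<bar> \<le> e"
    if "A \<in> S" for A
  proof -
    have A: "A \<in> sets borel" using that S by auto
    then have AU: "A \<times> UNIV \<in> sets (borel :: ('a \<times> 'a) measure)" "UNIV \<times> A \<in> sets (borel :: ('a \<times> 'a) measure)"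
      by (auto intro!: sets_borel_Times)
    have "measure (K u) (A \<times> UNIV) = measure (P (v (\<kappa> u))) A" "measure (K u) (UNIV \<times> A) = measure (Q (v (\<kappa> u))) A" for u
      unfolding K_def using coupling_marginals[OF H(1) A] by auto
    note KPQ = this
    have "(\<lambda>u. measure (P (v (\<kappa> u))) A) \<in> borel_measurable M" "(\<lambda>u. measure (Q (v (\<kappa> u))) A) \<in> borel_measurable M"
      using Km[OF AU(1)] Km[OF AU(2)] by (simp_all add: KPQ)
    then show ?thesis
      unfolding \<Gamma>_def measure_bind_Pr[OF M P A] measure_bind_Pr[OF M Q A] measure_bind_Pr[OF M Kb AU(1)] measure_bind_Pr[OF M Kb AU(2)]
      unfolding KPQ using close[OF that] Pm[OF A] Qm[OF A]
      by (intro conjI M.integral_diff_le) (simp_all add: le1 PQprob)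
  qed
  moreover have "(\<integral>\<^sup>+p. ennreal (case_prod c p) \<partial>\<Gamma>) \<le> (\<integral>\<^sup>+u. F u \<partial>M) + ennreal e"
  proof -
    have "(\<integral>\<^sup>+p. ennreal (case_prod c p) \<partial>\<Gamma>) = (\<integral>\<^sup>+u. \<integral>\<^sup>+p. ennreal (case_prod c p) \<partial>K u \<partial>M)"
      unfolding \<Gamma>_def using lsc_borel[OF c] measurable_prob_algebraD[OF K]
      by (intro nn_integral_bind) auto
    also have "\<dots> \<le> (\<integral>\<^sup>+u. (\<Sum>j\<in>J. F (v j) * indicator {u. \<kappa> u = j} u) + ennreal e \<partial>M)"
    proof (rule nn_integral_mono)
      fix u
      have "(\<Sum>j\<in>J. F (v j) * indicator {u. \<kappa> u = j} u) = (\<Sum>j\<in>{\<kappa> u}. F (v j) * indicator {u. \<kappa> u = j} u)"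
        using J by (intro sum.mono_neutral_right) (auto simp: J_def)
      then have "(\<Sum>j\<in>J. F (v j) * indicator {u. \<kappa> u = j} u) = F (v (\<kappa> u))" by simp
      then show "(\<integral>\<^sup>+p. ennreal (case_prod c p) \<partial>K u) \<le> (\<Sum>j\<in>J. F (v j) * indicator {u. \<kappa> u = j} u) + ennreal e"
        using H(2)[of "v (\<kappa> u)"] unfolding K_def by simp
    qed
    also have "\<dots> = (\<Sum>j\<in>J. F (v j) * emeasure M {u. \<kappa> u = j}) + ennreal e"
      using cell by (subst nn_integral_add) (auto simp: nn_integral_sum nn_integral_cmult_indicator M.emeasure_space_1)
    also have "\<dots> \<le> (\<Sum>j\<in>J. \<integral>\<^sup>+u. F u * indicator {u. \<kappa> u = j} u \<partial>M) + ennreal e"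
      by (intro add_mono sum_mono v order_refl)
    also have "(\<Sum>j\<in>J. \<integral>\<^sup>+u. F u * indicator {u. \<kappa> u = j} u \<partial>M) = (\<integral>\<^sup>+u. (\<Sum>j\<in>J. F u * indicator {u. \<kappa> u = j} u) \<partial>M)"
      using cell by (intro nn_integral_sum[symmetric]) auto
    also have "\<dots> = (\<integral>\<^sup>+u. F u \<partial>M)"
    proof (rule nn_integral_cong)
      fix u
      have "(\<Sum>j\<in>J. F u * indicator {u. \<kappa> u = j} u) = (\<Sum>j\<in>{\<kappa> u}. F u * indicator {u. \<kappa> u = j} u)"
        using J by (intro sum.mono_neutral_right) (auto simp: J_def indicator_def)
      then show "(\<Sum>j\<in>J. F u * indicator {u. \<kappa> u = j} u) = F u" by simp
    qed
    finally show ?thesis .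
  qed
  ultimately show ?thesis by (intro bexI[OF _ \<Gamma>]) simp
qed

text \<open>
  The approximating measures are indexed by finite sets \<open>S\<close> of demands, a demand \<open>(A, n)\<close> asking for accuracy
  \<open>1 / Suc n\<close> on the Borel set \<open>A\<close> and in the cost. Along the directed set of all \<open>S\<close> every
  demand is eventually met, so \<open>couplings_cluster\<close> applies.
\<close>

lemma wasserstein_mixture:
  fixes P Q :: "'c::topological_space \<Rightarrow> 'a::{second_countable_topology, complete_space} measure"
  assumes M: "M \<in> Pr" and P: "P \<in> borel \<rightarrow>\<^sub>M prob_algebra borel" and Q: "Q \<in> borel \<rightarrow>\<^sub>M prob_algebra borel"
    and c: "lsc (case_prod c)" "\<And>u v. 0 \<le> c u v" and F: "F \<in> borel_measurable borel"
    and W: "\<And>u. wasserstein c (P u) (Q u) \<le> F u"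
  shows "wasserstein c (M \<bind> P) (M \<bind> Q) \<le> (\<integral>\<^sup>+u. F u \<partial>M)"
proof -
  define ok where "ok S \<Gamma> \<longleftrightarrow> (\<forall>(A, n)\<in>S. \<bar>measure \<Gamma> (A \<times> UNIV) - measure (M \<bind> P) A\<bar> \<le> 1 / real (Suc n) \<and>
        \<bar>measure \<Gamma> (UNIV \<times> A) - measure (M \<bind> Q) A\<bar> \<le> 1 / real (Suc n) \<and>
      (\<integral>\<^sup>+p. ennreal (case_prod c p) \<partial>\<Gamma>) \<le> (\<integral>\<^sup>+u. F u \<partial>M) + ennreal (1 / real (Suc n)))"
    for S :: "('a set \<times> nat) set" and \<Gamma> :: "('a \<times> 'a) measure"
  have ex: "\<exists>\<Gamma>\<in>Pr. finite S \<and> S \<subseteq> sets borel \<times> UNIV \<longrightarrow> ok S \<Gamma>" for S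
  proof (cases "finite S \<and> S \<subseteq> sets borel \<times> UNIV")
    case True
    define N where "N = Max (insert 0 (snd ` S))"
    have N: "1 / real (Suc N) \<le> 1 / real (Suc n)" if "(A, n) \<in> S" for A n
    proof -
      have "n \<le> N" unfolding N_def using that True by (intro Max_ge) force+
      then show ?thesis by (intro divide_left_mono) auto
    qed
    have "\<exists>\<Gamma>\<in>Pr. (\<forall>A\<in>fst ` S. \<bar>measure \<Gamma> (A \<times> UNIV) - measure (M \<bind> P) A\<bar> \<le> 1 / real (Suc N) \<and>
        \<bar>measure \<Gamma> (UNIV \<times> A) - measure (M \<bind> Q) A\<bar> \<le> 1 / real (Suc N)) \<and>
      (\<integral>\<^sup>+p. ennreal (case_prod c p) \<partial>\<Gamma>) \<le> (\<integral>\<^sup>+u. F u \<partial>M) + ennreal (1 / real (Suc N))"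
      by (rule approximate_mixture[OF M P Q c(1) F W]) (use True in auto)
    then obtain \<Gamma> where \<Gamma>: "\<Gamma> \<in> Pr"
      "\<forall>A\<in>fst ` S. \<bar>measure \<Gamma> (A \<times> UNIV) - measure (M \<bind> P) A\<bar> \<le> 1 / real (Suc N) \<and>
        \<bar>measure \<Gamma> (UNIV \<times> A) - measure (M \<bind> Q) A\<bar> \<le> 1 / real (Suc N)"
      "(\<integral>\<^sup>+p. ennreal (case_prod c p) \<partial>\<Gamma>) \<le> (\<integral>\<^sup>+u. F u \<partial>M) + ennreal (1 / real (Suc N))"
      by (elim bexE conjE)
    have "ok S \<Gamma>" unfolding ok_def
    proof (clarify, intro conjI)
      fix A n assume An: "(A, n) \<in> S"
      then have "A \<in> fst ` S" by force
      from \<Gamma>(2)[rule_format, OF this] show "\<bar>measure \<Gamma> (A \<times> UNIV) - measure (M \<bind> P) A\<bar> \<le> 1 / real (Suc n)"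
        "\<bar>measure \<Gamma> (UNIV \<times> A) - measure (M \<bind> Q) A\<bar> \<le> 1 / real (Suc n)"
        using N[OF An] by auto
      show "(\<integral>\<^sup>+p. ennreal (case_prod c p) \<partial>\<Gamma>) \<le> (\<integral>\<^sup>+u. F u \<partial>M) + ennreal (1 / real (Suc n))"
        by (rule order_trans[OF \<Gamma>(3)]) (intro add_mono order_refl ennreal_leI N[OF An])
    qed
    then show ?thesis using \<Gamma>(1) by blast
  next
    case False
    then show ?thesis using approximate_mixture[OF M P Q c(1) F W, of "{}" 1] by auto
  qed
  have "\<forall>S. \<exists>\<Gamma>. \<Gamma> \<in> Pr \<and> (finite S \<and> S \<subseteq> sets borel \<times> UNIV \<longrightarrow> ok S \<Gamma>)"
    by (rule allI) (rule ex[unfolded Bex_def])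
  from choice[OF this] obtain \<Gamma> where
    \<Gamma>': "\<forall>S. \<Gamma> S \<in> Pr \<and> (finite S \<and> S \<subseteq> sets borel \<times> UNIV \<longrightarrow> ok S (\<Gamma> S))"
    by (rule exE)
  have \<Gamma>: "\<Gamma> S \<in> Pr" and good: "finite S \<Longrightarrow> S \<subseteq> sets borel \<times> UNIV \<Longrightarrow> ok S (\<Gamma> S)" for S
    using \<Gamma>' by simp_all
  define \<F> where "\<F> = finite_subsets_at_top (sets (borel :: 'a measure) \<times> (UNIV :: nat set))"
  have ev: "\<forall>\<^sub>F S in \<F>. ok {(A, n)} (\<Gamma> S)" if "A \<in> sets borel" for A n
    unfolding \<F>_def eventually_finite_subsets_at_top
  proof (intro exI[of _ "{(A, n)}"] conjI allI impI)
    fix S assume S: "finite S \<and> {(A, n)} \<subseteq> S \<and> S \<subseteq> sets borel \<times> UNIV"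
    then have "ok S (\<Gamma> S)" by (intro good) auto
    then show "ok {(A, n)} (\<Gamma> S)" using S unfolding ok_def by blast
  qed (use that in auto)
  have small: "\<exists>n. 1 / real (Suc n) < e" if "0 < e" for e :: real
    using reals_Archimedean[OF that] by (simp add: inverse_eq_divide)
  have BP: "M \<bind> P \<in> Pr" "M \<bind> Q \<in> Pr"
    using prob_space_bind'[OF M P] sets_bind'[OF M P] prob_space_bind'[OF M Q] sets_bind'[OF M Q]
    by (simp_all add: Pr_iff)
  have "\<exists>\<Delta>\<in>couplings (M \<bind> P) (M \<bind> Q).
     (\<forall>A B. A \<in> sets borel \<longrightarrow> B \<in> sets borel \<longrightarrow> (\<forall>\<^sub>F S in \<F>. measure (\<Gamma> S) (A \<times> B) = 0) \<longrightarrow>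
        measure \<Delta> (A \<times> B) = 0) \<and>
     (\<forall>c K. lsc c \<longrightarrow> (\<forall>p. 0 \<le> c p) \<longrightarrow> (\<forall>e>0. \<forall>\<^sub>F S in \<F>. (\<integral>\<^sup>+p. ennreal (c p) \<partial>\<Gamma> S) \<le> K + ennreal e) \<longrightarrow>
        (\<integral>\<^sup>+p. ennreal (c p) \<partial>\<Delta>) \<le> K)"
  proof (rule couplings_cluster[OF _ \<Gamma> BP])
    show "\<F> \<noteq> bot" by (simp add: \<F>_def)
    fix A :: "'a set" assume A: "A \<in> sets borel"
    show "((\<lambda>S. measure (\<Gamma> S) (A \<times> UNIV)) \<longlongrightarrow> measure (M \<bind> P) A) \<F>"
    proof (rule tendstoI)
      fix e :: real assume "0 < e"
      then obtain n where "1 / real (Suc n) < e" using small by blast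
      then show "\<forall>\<^sub>F S in \<F>. dist (measure (\<Gamma> S) (A \<times> UNIV)) (measure (M \<bind> P) A) < e"
        by (intro eventually_mono[OF ev[OF A, of n]]) (auto simp: ok_def dist_real_def)
    qed
    show "((\<lambda>S. measure (\<Gamma> S) (UNIV \<times> A)) \<longlongrightarrow> measure (M \<bind> Q) A) \<F>"
    proof (rule tendstoI)
      fix e :: real assume "0 < e"
      then obtain n where "1 / real (Suc n) < e" using small by blast
      then show "\<forall>\<^sub>F S in \<F>. dist (measure (\<Gamma> S) (UNIV \<times> A)) (measure (M \<bind> Q) A) < e"
        by (intro eventually_mono[OF ev[OF A, of n]]) (auto simp: ok_def dist_real_def)
    qed
  qed
  then obtain \<Delta> where \<Delta>: "\<Delta> \<in> couplings (M \<bind> P) (M \<bind> Q)"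
    and lim: "\<forall>c K. lsc c \<longrightarrow> (\<forall>p. 0 \<le> c p) \<longrightarrow> (\<forall>e>0. \<forall>\<^sub>F S in \<F>. (\<integral>\<^sup>+p. ennreal (c p) \<partial>\<Gamma> S) \<le> K + ennreal e) \<longrightarrow>
        (\<integral>\<^sup>+p. ennreal (c p) \<partial>\<Delta>) \<le> K"
    by (elim bexE conjE)
  have "wasserstein c (M \<bind> P) (M \<bind> Q) \<le> (\<integral>\<^sup>+p. ennreal (case_prod c p) \<partial>\<Delta>)"
    by (rule wasserstein_le[OF \<Delta>])
  also have "\<dots> \<le> (\<integral>\<^sup>+u. F u \<partial>M)"
  proof (rule lim[rule_format, OF c(1)])
    show "0 \<le> case_prod c p" for p using c(2) by (cases p) auto
    fix e :: real assume "0 < e"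
    then obtain n where n: "1 / real (Suc n) < e" using small by blast
    \<comment> \<open>On the empty set, the demand concerns the cost alone.\<close>
    have "\<forall>\<^sub>F S in \<F>. ok {({}, n)} (\<Gamma> S)" by (rule ev) simp
    then show "\<forall>\<^sub>F S in \<F>. (\<integral>\<^sup>+p. ennreal (case_prod c p) \<partial>\<Gamma> S) \<le> (\<integral>\<^sup>+u. F u \<partial>M) + ennreal e"
    proof (rule eventually_mono)
      fix S assume "ok {({}, n)} (\<Gamma> S)"
      then have "(\<integral>\<^sup>+p. ennreal (case_prod c p) \<partial>\<Gamma> S) \<le> (\<integral>\<^sup>+u. F u \<partial>M) + ennreal (1 / real (Suc n))"
        by (simp add: ok_def)
      also have "\<dots> \<le> (\<integral>\<^sup>+u. F u \<partial>M) + ennreal e" using n by (intro add_mono ennreal_leI) auto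
      finally show "(\<integral>\<^sup>+p. ennreal (case_prod c p) \<partial>\<Gamma> S) \<le> (\<integral>\<^sup>+u. F u \<partial>M) + ennreal e" .
    qed
  qed
  finally show ?thesis .
qed

section \<open>Operations on costs\<close>

lemma wasserstein_mono:
  assumes "\<And>u v. c u v \<le> c' u v"
  shows "wasserstein c \<mu> \<nu> \<le> wasserstein c' \<mu> \<nu>"
  unfolding wasserstein_def
  by (rule INF_mono') (auto intro!: nn_integral_mono ennreal_leI assms)

lemma wasserstein_cmult:
  assumes "0 < a" and c: "case_prod c \<in> borel_measurable borel" "\<And>u v. 0 \<le> c u v"
  shows "wasserstein (\<lambda>u v. a * c u v) \<mu> \<nu> \<le> ennreal a * wasserstein c \<mu> \<nu>"
proof (cases "wasserstein c \<mu> \<nu> < \<top>")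
  case True
  show ?thesis
  proof (rule ennreal_le_epsilon)
    fix e :: real assume "0 < e"
    then have "0 < e / a" using assms by simp
    then obtain \<Gamma> where \<Gamma>: "\<Gamma> \<in> couplings \<mu> \<nu>"
      "(\<integral>\<^sup>+p. ennreal (case_prod c p) \<partial>\<Gamma>) \<le> wasserstein c \<mu> \<nu> + ennreal (e / a)"
      by (rule wasserstein_near_optimal[OF True])
    have cm: "case_prod c \<in> borel_measurable \<Gamma>"
      using c(1) couplingsD(2)[OF \<Gamma>(1)] by (simp cong: measurable_cong_sets)
    have "wasserstein (\<lambda>u v. a * c u v) \<mu> \<nu> \<le> (\<integral>\<^sup>+p. ennreal (a * case_prod c p) \<partial>\<Gamma>)"
      using wasserstein_le[OF \<Gamma>(1), of "\<lambda>u v. a * c u v"] by (simp add: case_prod_beta')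
    also have "\<dots> = ennreal a * (\<integral>\<^sup>+p. ennreal (case_prod c p) \<partial>\<Gamma>)"
      using assms cm by (simp add: ennreal_mult' nn_integral_cmult)
    also have "\<dots> \<le> ennreal a * (wasserstein c \<mu> \<nu> + ennreal (e / a))"
      by (intro mult_left_mono \<Gamma>) simp
    also have "\<dots> = ennreal a * wasserstein c \<mu> \<nu> + ennreal e"
      using assms \<open>0 < e\<close> by (simp add: distrib_left ennreal_mult[symmetric])
    finally show "wasserstein (\<lambda>u v. a * c u v) \<mu> \<nu> \<le> ennreal a * wasserstein c \<mu> \<nu> + ennreal e" .
  qed
next
  case False
  then show ?thesis using assms by (simp add: not_less top_unique ennreal_mult_top)
qed

lemma wasserstein_bounded:
  fixes \<mu> \<nu> :: "'a::second_countable_topology measure"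
  assumes "\<mu> \<in> Pr" "\<nu> \<in> Pr" "\<And>u v. c u v \<le> b"
  shows "wasserstein c \<mu> \<nu> \<le> ennreal b"
proof -
  note \<Gamma> = couplings_nonempty[OF assms(1,2)]
  have "wasserstein c \<mu> \<nu> \<le> (\<integral>\<^sup>+p. ennreal (case_prod c p) \<partial>(\<mu> \<Otimes>\<^sub>M \<nu>))" by (rule wasserstein_le[OF \<Gamma>])
  also have "\<dots> \<le> (\<integral>\<^sup>+p. ennreal b \<partial>(\<mu> \<Otimes>\<^sub>M \<nu>))"
    by (intro nn_integral_mono ennreal_leI) (auto simp: assms)
  also have "\<dots> = ennreal b" using prob_space.emeasure_space_1[OF couplingsD(1)[OF \<Gamma>]] by simp
  finally show ?thesis .
qed

lemma return_Pr: "return borel x \<in> Pr"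
  by (simp add: Pr_iff prob_space_return)

lemma wasserstein_return:
  fixes u v :: "'a::second_countable_topology"
  assumes "case_prod c \<in> borel_measurable borel"
  shows "wasserstein c (return borel u) (return borel v) \<le> ennreal (c u v)"
proof -
  have "return borel (u, v) \<in> couplings (return borel u) (return borel v)"
    using measurable_fst_snd_borel[OF refl, where 'a='a] return_Pr[of "(u, v)"]
    by (simp add: couplings_def distr_return)
  from wasserstein_le[OF this, of c] show ?thesis
    using assms by (simp add: nn_integral_return)
qed

lemma wasserstein_self:
  fixes \<mu> :: "'a::second_countable_topology measure"
  assumes \<mu>: "\<mu> \<in> Pr" and c: "case_prod c \<in> borel_measurable borel" "\<And>u. c u u = 0"
  shows "wasserstein c \<mu> \<mu> = 0"
proof -
  have s[measurable_cong]: "sets \<mu> = sets borel" and p: "prob_space \<mu>" using \<mu> by (auto simp: Pr_iff)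
  have d: "(\<lambda>u. (u, u)) \<in> \<mu> \<rightarrow>\<^sub>M (borel :: ('a \<times> 'a) measure)"
    unfolding borel_prod[symmetric] by measurable
  note f = measurable_fst_snd_borel[OF refl, where 'a='a]
  have "distr \<mu> borel (\<lambda>u. (u, u)) \<in> couplings \<mu> \<mu>"
    using prob_space.prob_space_distr[OF p d] distr_id2[OF s[symmetric]]
    by (simp add: couplings_def Pr_iff distr_distr[OF f(1) d] distr_distr[OF f(2) d] comp_def id_def)
  from wasserstein_le[OF this, of c] show ?thesis
    using c by (simp add: nn_integral_distr[OF d])
qed

lemma lsc_min: "lsc c \<Longrightarrow> lsc (\<lambda>p. min (c p) L)"
proof -
  assume c: "lsc c"
  have "{p. t < min (c p) L} = (if t < L then {p. t < c p} else {})" for t by auto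
  then show ?thesis using c by (simp add: lsc_def)
qed

lemma lsc_cmult: "lsc c \<Longrightarrow> 0 < a \<Longrightarrow> lsc (\<lambda>p. a * c p)"
proof -
  assume c: "lsc c" and a: "0 < a"
  have "{p. t < a * c p} = {p. t / a < c p}" for t using a by (auto simp: field_simps)
  then show ?thesis using c by (simp add: lsc_def)
qed

section \<open>The weighted costs\<close>

lemma lsc_weighted:
  fixes \<rho> :: "'a::real_normed_vector \<Rightarrow> 'a \<Rightarrow> real"
  assumes "distance_like \<rho>"
  shows "lsc (case_prod (weighted \<rho> a))"
  unfolding lsc_def
proof
  fix t
  define e where "e p = exp (a * (norm (fst p))\<^sup>2 + a * (norm (snd p))\<^sup>2)" for p :: "'a \<times> 'a"
  have e: "0 < e p" for p by (simp add: e_def)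
  have w: "case_prod (weighted \<rho> a) p = sqrt (case_prod \<rho> p) * e p" for p
    by (cases p) (simp add: weighted_def e_def)
  have nn: "0 \<le> case_prod \<rho> p" for p using assms by (cases p) (simp add: distance_like_def)
  have \<rho>: "open {p. s < case_prod \<rho> p}" for s
  proof (subst open_subopen, intro ballI)
    fix p assume "p \<in> {p. s < case_prod \<rho> p}"
    then have "\<forall>\<^sub>F q in nhds p. s < case_prod \<rho> q"
      using assms unfolding distance_like_def by blast
    then show "\<exists>T. open T \<and> p \<in> T \<and> T \<subseteq> {p. s < case_prod \<rho> p}"
      unfolding eventually_nhds by blast
  qed
  show "open {p. t < case_prod (weighted \<rho> a) p}"
  proof (cases "t < 0")
    case True
    have "{p. t < case_prod (weighted \<rho> a) p} = UNIV"
    proof -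
      have "0 \<le> case_prod (weighted \<rho> a) p" for p
        using nn[of p] e[of p] unfolding w by simp
      then show ?thesis using less_le_trans[OF True] by blast
    qed
    then show ?thesis by simp
  next
    case False
    \<comment> \<open>A product of nonnegative numbers exceeds \<open>t\<close> iff some \<open>s\<close> below the first factor still suffices.\<close>
    have "{p. t < case_prod (weighted \<rho> a) p} = (\<Union>s\<in>{0..}. {p. s\<^sup>2 < case_prod \<rho> p} \<inter> {p. t < s * e p})"
    proof (intro set_eqI iffI)
      fix p assume "p \<in> {p. t < case_prod (weighted \<rho> a) p}"
      then have "t / e p < sqrt (case_prod \<rho> p)" using e[of p] unfolding w by (simp add: field_simps)
      then obtain s where s: "t / e p < s" "s < sqrt (case_prod \<rho> p)" using dense by blast
      have "0 \<le> t / e p" using False e[of p] by simp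
      then have "0 \<le> s" using s by linarith
      moreover have "s\<^sup>2 < case_prod \<rho> p"
        using s(2) \<open>0 \<le> s\<close> nn[of p] by (metis power_strict_mono pos2 real_sqrt_pow2)
      moreover have "t < s * e p" using s(1) e[of p] by (simp add: field_simps)
      ultimately show "p \<in> (\<Union>s\<in>{0..}. {p. s\<^sup>2 < case_prod \<rho> p} \<inter> {p. t < s * e p})" by auto
    next
      fix p assume "p \<in> (\<Union>s\<in>{0..}. {p. s\<^sup>2 < case_prod \<rho> p} \<inter> {p. t < s * e p})"
      then obtain s where s: "0 \<le> s" "s\<^sup>2 < case_prod \<rho> p" "t < s * e p" by auto
      have "s \<le> sqrt (case_prod \<rho> p)" using s(1,2) by (intro real_le_rsqrt) simp
      then have "s * e p \<le> sqrt (case_prod \<rho> p) * e p" using e[of p] by (intro mult_right_mono) auto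
      then show "p \<in> {p. t < case_prod (weighted \<rho> a) p}" using s(3) unfolding w by simp
    qed
    moreover have "open {p. t < s * e p}" for s
      unfolding e_def by (intro open_Collect_less continuous_intros)
    ultimately show ?thesis using \<rho> by (auto intro!: open_UN open_Int)
  qed
qed

lemma weighted_nonneg: "distance_like \<rho> \<Longrightarrow> 0 \<le> weighted \<rho> a u v"
  by (simp add: weighted_def distance_like_def)

lemma weighted_le_sum:
  assumes "distance_like \<rho>" "\<rho> u v \<le> 1"
  shows "weighted \<rho> a u v \<le> exp (2 * a * (norm u)\<^sup>2) + exp (2 * a * (norm v)\<^sup>2)"
proof -
  define x where "x = exp (a * (norm u)\<^sup>2)"
  define y where "y = exp (a * (norm v)\<^sup>2)"
  have "weighted \<rho> a u v \<le> 1 * (x * y)"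
    unfolding weighted_def x_def y_def exp_add using assms
    by (intro mult_right_mono) auto
  also have "1 * (x * y) \<le> x\<^sup>2 + y\<^sup>2"
  proof -
    have "0 \<le> x * y" by (simp add: x_def y_def)
    moreover have "0 \<le> (x - y)\<^sup>2" by simp
    ultimately show ?thesis by (simp add: power2_diff)
  qed
  also have "\<dots> = exp (2 * a * (norm u)\<^sup>2) + exp (2 * a * (norm v)\<^sup>2)"
    by (simp add: x_def y_def exp_double[symmetric] mult_ac)
  finally show ?thesis .
qed

section \<open>Absorption without moment assumptions\<close>

lemma tail_tendsto_0:
  fixes \<phi> :: "'a::topological_space \<Rightarrow> real"
  assumes "\<mu> \<in> Pr" "\<phi> \<in> borel_measurable borel"
  shows "(\<lambda>n. measure \<mu> {u. real n / 2 < \<phi> u}) \<longlonglongrightarrow> 0"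
proof -
  interpret prob_space \<mu> using assms by (simp add: Pr_iff)
  have s: "sets \<mu> = sets borel" using assms by (simp add: Pr_iff)
  have r: "range (\<lambda>n. {u. real n / 2 < \<phi> u}) \<subseteq> sets \<mu>"
    unfolding s using assms(2) by auto
  have d: "decseq (\<lambda>n. {u. real n / 2 < \<phi> u})"
    by (auto simp: decseq_def intro: order_le_less_trans[rotated])
  have e: "(\<Inter>n. {u. real n / 2 < \<phi> u}) = {}"
  proof (intro equals0I)
    fix u assume "u \<in> (\<Inter>n. {u. real n / 2 < \<phi> u})"
    moreover obtain n where "2 * \<phi> u < real n" using reals_Archimedean2 by blast
    ultimately show False by (auto dest!: spec[of _ n])
  qed
  show ?thesis using finite_Lim_measure_decseq[OF r d] by (simp only: e measure_empty)
qed

text \<open>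
  For bounded \<open>c\<close> the hypothesis \<open>half\<close> implies \<open>W \<le> W / 2 + E\<close> and the claim is immediate. In general,
  halving before truncating at \<open>n\<close> gains nothing where \<open>c\<close> is far above \<open>n\<close>, so no estimate for \<open>min c n\<close> itself
  results, only one on the set \<open>c \<le> n\<close>. For a fixed level \<open>k\<close> this is enough: the integral of \<open>min c k\<close>
  over the complement is at most \<open>k\<close> times a probability that tends to zero as \<open>n\<close> grows.
\<close>

lemma wasserstein_absorb:
  fixes c :: "'a::{second_countable_topology, complete_space} \<Rightarrow> 'a \<Rightarrow> real"
  assumes \<mu>: "\<mu> \<in> Pr" and \<nu>: "\<nu> \<in> Pr" and c: "lsc (case_prod c)" "\<And>u v. 0 \<le> c u v"
    and \<phi>: "\<phi> \<in> borel_measurable borel" "\<And>u v. c u v \<le> \<phi> u + \<phi> v"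
    and half: "\<And>n \<Gamma>. \<Gamma> \<in> couplings \<mu> \<nu> \<Longrightarrow>
      wasserstein (\<lambda>u v. min (c u v) (real n)) \<mu> \<nu> \<le> (\<integral>\<^sup>+p. ennreal (min (case_prod c p / 2) (real n)) \<partial>\<Gamma>) + E"
  shows "wasserstein c \<mu> \<nu> \<le> 2 * E"
proof -
  let ?c = "case_prod c"
  have cb: "?c \<in> borel_measurable borel" by (rule lsc_borel[OF c(1)])
  have c0: "0 \<le> ?c p" for p using c(2) by (cases p) auto
  have "\<exists>\<Gamma>\<in>couplings \<mu> \<nu>. (\<integral>\<^sup>+p. ennreal (min (?c p) (real n)) \<partial>\<Gamma>)
      \<le> wasserstein (\<lambda>u v. min (c u v) (real n)) \<mu> \<nu> + ennreal (1 / real (Suc n))" for n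
  proof -
    have "wasserstein (\<lambda>u v. min (c u v) (real n)) \<mu> \<nu> \<le> ennreal (real n)"
      by (rule wasserstein_bounded[OF \<mu> \<nu>]) simp
    then have "wasserstein (\<lambda>u v. min (c u v) (real n)) \<mu> \<nu> < \<top>"
      by (rule order_le_less_trans) simp
    then obtain \<Gamma> where "\<Gamma> \<in> couplings \<mu> \<nu>"
      "(\<integral>\<^sup>+p. ennreal (case_prod (\<lambda>u v. min (c u v) (real n)) p) \<partial>\<Gamma>)
        \<le> wasserstein (\<lambda>u v. min (c u v) (real n)) \<mu> \<nu> + ennreal (1 / real (Suc n))"
      by (rule wasserstein_near_optimal) auto
    then show ?thesis by (intro bexI[of _ \<Gamma>]) (simp_all add: case_prod_beta')
  qed
  then have "\<forall>n. \<exists>\<Gamma>. \<Gamma> \<in> couplings \<mu> \<nu> \<and> (\<integral>\<^sup>+p. ennreal (min (?c p) (real n)) \<partial>\<Gamma>)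
      \<le> wasserstein (\<lambda>u v. min (c u v) (real n)) \<mu> \<nu> + ennreal (1 / real (Suc n))" by blast
  from choice[OF this] obtain \<Gamma> where \<Gamma>': "\<forall>n. \<Gamma> n \<in> couplings \<mu> \<nu> \<and>
      (\<integral>\<^sup>+p. ennreal (min (?c p) (real n)) \<partial>\<Gamma> n)
      \<le> wasserstein (\<lambda>u v. min (c u v) (real n)) \<mu> \<nu> + ennreal (1 / real (Suc n))"
    by (rule exE)
  have \<Gamma>: "\<Gamma> n \<in> couplings \<mu> \<nu>"
    and opt: "(\<integral>\<^sup>+p. ennreal (min (?c p) (real n)) \<partial>\<Gamma> n)
      \<le> wasserstein (\<lambda>u v. min (c u v) (real n)) \<mu> \<nu> + ennreal (1 / real (Suc n))" for n
    using \<Gamma>' by simp_all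
  note g = couplingsD[OF \<Gamma>]
  have cg: "?c \<in> borel_measurable (\<Gamma> n)" for n using cb g(2) by (simp cong: measurable_cong_sets)
  \<comment> \<open>The difference of \<open>min c n\<close> and \<open>min (c / 2) n\<close> is nonnegative, and it is \<open>c / 2\<close> where \<open>c \<le> n\<close>.\<close>
  have low: "(\<integral>\<^sup>+p. ennreal (?c p / 2) * indicator {p. ?c p \<le> n} p \<partial>\<Gamma> n) \<le> E + ennreal (1 / real (Suc n))" for n
  proof -
    let ?b = "\<integral>\<^sup>+p. ennreal (min (?c p / 2) (real n)) \<partial>\<Gamma> n"
    have "{p. ?c p \<le> n} \<in> sets (\<Gamma> n)" using cg[of n] g(3)[of n] by (auto simp: borel_measurable_iff_le)
    then have ind: "indicator {p. ?c p \<le> n} \<in> borel_measurable (\<Gamma> n)" by (rule borel_measurable_indicator)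
    have "?b + (\<integral>\<^sup>+p. ennreal (?c p / 2) * indicator {p. ?c p \<le> n} p \<partial>\<Gamma> n)
       = (\<integral>\<^sup>+p. ennreal (min (?c p / 2) (real n)) + ennreal (?c p / 2) * indicator {p. ?c p \<le> n} p \<partial>\<Gamma> n)"
      using cg[of n] ind by (intro nn_integral_add[symmetric]) auto
    also have "\<dots> \<le> (\<integral>\<^sup>+p. ennreal (min (?c p) (real n)) \<partial>\<Gamma> n)"
    proof (rule nn_integral_mono)
      fix p
      show "ennreal (min (?c p / 2) (real n)) + ennreal (?c p / 2) * indicator {p. ?c p \<le> n} p
          \<le> ennreal (min (?c p) (real n))"
        using c0[of p]
        by (cases "?c p \<le> n") (auto simp: min_def ennreal_plus[symmetric] simp del: ennreal_plus intro!: ennreal_leI)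
    qed
    also have "\<dots> \<le> (?b + E) + ennreal (1 / real (Suc n))"
      by (rule order_trans[OF opt]) (intro add_mono half \<Gamma> order_refl)
    finally have "?b + (\<integral>\<^sup>+p. ennreal (?c p / 2) * indicator {p. ?c p \<le> n} p \<partial>\<Gamma> n)
        \<le> ?b + (E + ennreal (1 / real (Suc n)))" by (simp add: add.assoc)
    moreover have "?b < \<top>"
    proof -
      interpret prob_space "\<Gamma> n" by (rule g)
      have "?b \<le> (\<integral>\<^sup>+p. ennreal (real n) \<partial>\<Gamma> n)" by (intro nn_integral_mono ennreal_leI) simp
      also have "\<dots> < \<top>" by (simp add: emeasure_space_1)
      finally show ?thesis .
    qed
    ultimately show ?thesis by (auto simp: ennreal_add_left_cancel_le)
  qed
  \<comment> \<open>If \<open>c u v > n\<close> then \<open>\<phi>\<close> exceeds \<open>n / 2\<close> at \<open>u\<close> or at \<open>v\<close>; this bounds the tail uniformly over all couplings.\<close>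
  define \<tau> where "\<tau> n = measure \<mu> {u. real n / 2 < \<phi> u} + measure \<nu> {u. real n / 2 < \<phi> u}" for n
  have tail: "measure (\<Gamma> n) {p. real n < ?c p} \<le> \<tau> n" for n
  proof -
    interpret prob_space "\<Gamma> n" by (rule g)
    let ?A = "{u. real n / 2 < \<phi> u}"
    have A: "?A \<in> sets borel" using \<phi>(1) by auto
    have AU: "?A \<times> UNIV \<in> sets (\<Gamma> n)" "UNIV \<times> ?A \<in> sets (\<Gamma> n)"
      unfolding g(2) using A by (auto intro!: sets_borel_Times)
    have "measure (\<Gamma> n) {p. real n < ?c p} \<le> measure (\<Gamma> n) (?A \<times> UNIV \<union> UNIV \<times> ?A)"
    proof (rule finite_measure_mono)
      show "{p. real n < ?c p} \<subseteq> ?A \<times> UNIV \<union> UNIV \<times> ?A"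
      proof
        fix p assume "p \<in> {p. real n < ?c p}"
        then have "real n < \<phi> (fst p) + \<phi> (snd p)"
          using \<phi>(2)[of "fst p" "snd p"] by (simp add: case_prod_beta')
        then have "real n / 2 < \<phi> (fst p) \<or> real n / 2 < \<phi> (snd p)" by linarith
        then show "p \<in> ?A \<times> UNIV \<union> UNIV \<times> ?A" by (auto simp: mem_Times_iff)
      qed
    qed (use AU in auto)
    also have "\<dots> \<le> measure (\<Gamma> n) (?A \<times> UNIV) + measure (\<Gamma> n) (UNIV \<times> ?A)"
      using AU by (rule measure_Un_le)
    finally show ?thesis unfolding \<tau>_def coupling_marginals[OF \<Gamma> A] .
  qed
  have \<tau>0: "\<tau> \<longlonglongrightarrow> 0" unfolding \<tau>_def
    using tendsto_add[OF tail_tendsto_0[OF \<mu> \<phi>(1)] tail_tendsto_0[OF \<nu> \<phi>(1)]] by simp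
  have trunc: "(\<integral>\<^sup>+p. ennreal (min (?c p) (real k)) \<partial>\<Gamma> n)
      \<le> 2 * E + ennreal (2 * (1 / real (Suc n)) + real k * \<tau> n)" for k n
  proof -
    interpret prob_space "\<Gamma> n" by (rule g)
    have S: "{p. ?c p \<le> n} \<in> sets (\<Gamma> n)" "{p. real n < ?c p} \<in> sets (\<Gamma> n)"
      using borel_measurable_iff_le[THEN iffD1, OF cg[of n]]
        borel_measurable_iff_greater[THEN iffD1, OF cg[of n]] g(3)[of n] by simp_all
    then have ind: "indicator {p. ?c p \<le> n} \<in> borel_measurable (\<Gamma> n)"
      "indicator {p. real n < ?c p} \<in> borel_measurable (\<Gamma> n)" by (auto intro: borel_measurable_indicator)
    have "(\<integral>\<^sup>+p. ennreal (min (?c p) (real k)) \<partial>\<Gamma> n)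
      \<le> (\<integral>\<^sup>+p. 2 * (ennreal (?c p / 2) * indicator {p. ?c p \<le> n} p) + ennreal (real k) * indicator {p. real n < ?c p} p \<partial>\<Gamma> n)"
    proof (rule nn_integral_mono)
      fix p
      have half_twice: "2 * ennreal (?c p / 2) = ennreal (?c p)"
        using c0[of p] by (subst ennreal_numeral[symmetric], subst ennreal_mult[symmetric]) auto
      show "ennreal (min (?c p) (real k))
          \<le> 2 * (ennreal (?c p / 2) * indicator {p. ?c p \<le> n} p) + ennreal (real k) * indicator {p. real n < ?c p} p"
      proof (cases "?c p \<le> n")
        case True
        then show ?thesis by (simp add: half_twice ennreal_leI)
      next
        case False
        then have "ennreal (min (?c p) (real k)) \<le> ennreal (real k)" by (intro ennreal_leI) simp
        then show ?thesis using False by simp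
      qed
    qed
    also have "\<dots> = 2 * (\<integral>\<^sup>+p. ennreal (?c p / 2) * indicator {p. ?c p \<le> n} p \<partial>\<Gamma> n)
        + ennreal (real k) * emeasure (\<Gamma> n) {p. real n < ?c p}"
      using cg[of n] ind S by (subst nn_integral_add) (auto simp: nn_integral_cmult nn_integral_cmult_indicator)
    also have "\<dots> \<le> 2 * (E + ennreal (1 / real (Suc n))) + ennreal (real k) * ennreal (\<tau> n)"
      using tail[of n] by (intro add_mono mult_left_mono low) (auto simp: emeasure_eq_measure intro: ennreal_leI)
    also have "\<dots> = 2 * E + ennreal (2 * (1 / real (Suc n)) + real k * \<tau> n)"
    proof -
      have "ennreal (2 * x + y * z) = 2 * ennreal x + ennreal y * ennreal z" if "0 \<le> x" "0 \<le> y" "0 \<le> z" for x y z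
        using that by (simp add: ennreal_mult)
      from this[of "1 / real (Suc n)" "real k" "\<tau> n"]
      have "ennreal (2 * (1 / real (Suc n)) + real k * \<tau> n)
          = 2 * ennreal (1 / real (Suc n)) + ennreal (real k) * ennreal (\<tau> n)"
        by (simp only: \<tau>_def) simp
      then show ?thesis by (simp add: distrib_left add.assoc)
    qed
    finally show ?thesis .
  qed
  have Pr: "\<Gamma> n \<in> Pr" for n using g by (simp add: Pr_iff)
  have "\<exists>\<Delta>\<in>couplings \<mu> \<nu>.
     (\<forall>A B. A \<in> sets borel \<longrightarrow> B \<in> sets borel \<longrightarrow> (\<forall>\<^sub>F i in sequentially. measure (\<Gamma> i) (A \<times> B) = 0) \<longrightarrow>
        measure \<Delta> (A \<times> B) = 0) \<and>
     (\<forall>c K. lsc c \<longrightarrow> (\<forall>p. 0 \<le> c p) \<longrightarrow> (\<forall>e>0. \<forall>\<^sub>F i in sequentially. (\<integral>\<^sup>+p. ennreal (c p) \<partial>\<Gamma> i) \<le> K + ennreal e) \<longrightarrow>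
        (\<integral>\<^sup>+p. ennreal (c p) \<partial>\<Delta>) \<le> K)"
    by (rule couplings_cluster[OF _ Pr \<mu> \<nu>]) (simp_all add: coupling_marginals[OF \<Gamma>])
  then obtain \<Delta> where \<Delta>: "\<Delta> \<in> couplings \<mu> \<nu>"
    and lim: "\<forall>c K. lsc c \<longrightarrow> (\<forall>p. 0 \<le> c p) \<longrightarrow> (\<forall>e>0. \<forall>\<^sub>F i in sequentially. (\<integral>\<^sup>+p. ennreal (c p) \<partial>\<Gamma> i) \<le> K + ennreal e) \<longrightarrow>
        (\<integral>\<^sup>+p. ennreal (c p) \<partial>\<Delta>) \<le> K"
    by (elim bexE conjE)
  have k: "(\<integral>\<^sup>+p. ennreal (min (?c p) (real k)) \<partial>\<Delta>) \<le> 2 * E" for k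
  proof (rule lim[rule_format, OF lsc_min[OF c(1)]])
    show "0 \<le> min (?c p) (real k)" for p using c0[of p] by simp
    fix e :: real assume "0 < e"
    have "(\<lambda>n. 2 * (1 / real (Suc n)) + real k * \<tau> n) \<longlonglongrightarrow> 2 * 0 + real k * 0"
      by (intro tendsto_intros \<tau>0 LIMSEQ_Suc[OF lim_1_over_n])
    then have "\<forall>\<^sub>F n in sequentially. 2 * (1 / real (Suc n)) + real k * \<tau> n < e"
      using \<open>0 < e\<close> by (intro order_tendstoD(2)) auto
    then show "\<forall>\<^sub>F n in sequentially. (\<integral>\<^sup>+p. ennreal (min (?c p) (real k)) \<partial>\<Gamma> n) \<le> 2 * E + ennreal e"
    proof (rule eventually_mono)
      fix n assume "2 * (1 / real (Suc n)) + real k * \<tau> n < e"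
      then show "(\<integral>\<^sup>+p. ennreal (min (?c p) (real k)) \<partial>\<Gamma> n) \<le> 2 * E + ennreal e"
        by (intro order_trans[OF trunc] add_mono order_refl ennreal_leI less_imp_le)
    qed
  qed
  have "wasserstein c \<mu> \<nu> \<le> (\<integral>\<^sup>+p. ennreal (?c p) \<partial>\<Delta>)" by (rule wasserstein_le[OF \<Delta>])
  also have "\<dots> = (\<integral>\<^sup>+p. (SUP k. ennreal (min (?c p) (real k))) \<partial>\<Delta>)"
  proof (intro nn_integral_cong antisym)
    fix p
    obtain k where "?c p < real k" using reals_Archimedean2 by blast
    then show "ennreal (?c p) \<le> (SUP k. ennreal (min (?c p) (real k)))"
      by (intro SUP_upper2[of k]) (auto simp: min_def)
    show "(SUP k. ennreal (min (?c p) (real k))) \<le> ennreal (?c p)"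
      by (intro SUP_least ennreal_leI) simp
  qed
  also have "\<dots> = (SUP k. \<integral>\<^sup>+p. ennreal (min (?c p) (real k)) \<partial>\<Delta>)"
  proof (rule nn_integral_monotone_convergence_SUP)
    show "incseq (\<lambda>k p. ennreal (min (?c p) (real k)))"
      by (auto simp: incseq_def le_fun_def intro!: ennreal_leI)
    have "?c \<in> borel_measurable \<Delta>" using cb couplingsD(2)[OF \<Delta>] by (simp cong: measurable_cong_sets)
    then show "(\<lambda>p. ennreal (min (?c p) (real k))) \<in> borel_measurable \<Delta>" for k by measurable
  qed
  also have "\<dots> \<le> 2 * E" by (intro SUP_least k)
  finally show ?thesis .
qed

section \<open>Stability of the invariant measure\<close>

text \<open>
  The contraction enters through point masses: for a coupling \<open>\<Gamma>\<close> of \<open>\<mu>\<close> and \<open>\<nu>\<close>, the measures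
  \<open>\<mu> = \<mu> P\<close> and \<open>\<nu> P\<close> are mixtures of \<open>P u\<close> and \<open>P v\<close> over \<open>\<Gamma>\<close>. This is what lets the contraction be
  combined with the truncation, since the truncated cost between \<open>P u\<close> and \<open>P v\<close> is at most \<open>n\<close> anyway.
\<close>

lemma invariant_measures_close:
  fixes c c' :: "'a::{second_countable_topology, complete_space} \<Rightarrow> 'a \<Rightarrow> real"
  assumes \<mu>: "\<mu> \<in> Pr" "\<mu> \<bind> P = \<mu>" and \<nu>: "\<nu> \<in> Pr" "\<nu> \<bind> Q = \<nu>"
    and PQ: "markov_kernel P" "markov_kernel Q"
    and c: "lsc (case_prod c)" "\<And>u v. 0 \<le> c u v" and c': "lsc (case_prod c')" "\<And>u v. 0 \<le> c' u v"
    and \<phi>: "\<phi> \<in> borel_measurable borel" "\<And>u v. c u v \<le> \<phi> u + \<phi> v"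
    and C: "0 < C" and tri: "\<And>u v w. c u v \<le> C * (c' u w + c' w v)"
    and \<kappa>: "0 \<le> \<kappa>" "C * \<kappa> \<le> 1/2"
    and contr: "\<And>u v. wasserstein c' (P u) (P v) \<le> ennreal (\<kappa> * c u v)"
    and F: "F \<in> borel_measurable borel" "\<And>u. wasserstein c' (P u) (Q u) \<le> F u"
  shows "wasserstein c \<mu> \<nu> \<le> 2 * (ennreal C * (\<integral>\<^sup>+u. F u \<partial>\<nu>))"
proof (rule wasserstein_absorb[OF \<mu>(1) \<nu>(1) c \<phi>])
  fix n :: nat and \<Gamma> assume \<Gamma>: "\<Gamma> \<in> couplings \<mu> \<nu>"
  note g = couplingsD[OF \<Gamma>]
  have gPr: "\<Gamma> \<in> Pr" using g by (simp add: Pr_iff)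
  have sub: "P \<in> borel \<rightarrow>\<^sub>M subprob_algebra borel" by (rule measurable_prob_algebraD[OF PQ(1)])
  have lC: "lsc (case_prod (\<lambda>u v. C * c' u v))"
    using lsc_cmult[OF c'(1) C] by (simp add: case_prod_beta')
  have lCn: "lsc (case_prod (\<lambda>u v. min (C * c' u v) (real n)))"
    using lsc_min[OF lsc_cmult[OF c'(1) C]] by (simp add: case_prod_beta')
  have lcn: "lsc (case_prod (\<lambda>u v. min (c u v) (real n)))"
    using lsc_min[OF c(1)] by (simp add: case_prod_beta')
  have "wasserstein (\<lambda>u v. min (c u v) (real n)) \<mu> \<nu>
      \<le> wasserstein (\<lambda>u v. min (C * c' u v) (real n)) \<mu> (\<nu> \<bind> P) + wasserstein (\<lambda>u v. C * c' u v) (\<nu> \<bind> P) \<nu>"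
  proof (rule wasserstein_triangle)
    show "min (c u v) (real n) \<le> min (C * c' u w) (real n) + C * c' w v" for u v w
    proof -
      have "0 \<le> C * c' w v" "0 \<le> C * c' u w" using C c'(2) by auto
      then show ?thesis using tri[of u v w] by (auto simp: min_def distrib_left)
    qed
  qed (use C c'(2) in \<open>auto intro!: lsc_borel lC lCn lcn\<close>)
  also have "wasserstein (\<lambda>u v. min (C * c' u v) (real n)) \<mu> (\<nu> \<bind> P)
      \<le> (\<integral>\<^sup>+p. ennreal (min (case_prod c p / 2) (real n)) \<partial>\<Gamma>)"
  proof -
    have ne: "space \<Gamma> \<noteq> {}" using g(3) by simp
    have "\<mu> = \<Gamma> \<bind> (\<lambda>p. P (fst p))"
      using bind_distr[OF measurable_fst_snd_borel(1)[OF g(2)] sub ne] g(4) \<mu>(2) by simp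
    moreover have "\<nu> \<bind> P = \<Gamma> \<bind> (\<lambda>p. P (snd p))"
      using bind_distr[OF measurable_fst_snd_borel(2)[OF g(2)] sub ne] g(5) by simp
    moreover have "wasserstein (\<lambda>u v. min (C * c' u v) (real n)) (\<Gamma> \<bind> (\<lambda>p. P (fst p))) (\<Gamma> \<bind> (\<lambda>p. P (snd p)))
       \<le> (\<integral>\<^sup>+p. ennreal (min (case_prod c p / 2) (real n)) \<partial>\<Gamma>)"
    proof (rule wasserstein_mixture[OF gPr _ _ lCn])
      note f = measurable_fst_snd_borel[OF refl, where 'a='a]
      show "(\<lambda>p :: 'a \<times> 'a. P (fst p)) \<in> borel \<rightarrow>\<^sub>M prob_algebra borel" by (rule measurable_compose[OF f(1) PQ(1)])
      show "(\<lambda>p :: 'a \<times> 'a. P (snd p)) \<in> borel \<rightarrow>\<^sub>M prob_algebra borel" by (rule measurable_compose[OF f(2) PQ(1)])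
      show "0 \<le> min (C * c' u v) (real n)" for u v using C c'(2) by simp
      show "(\<lambda>p. ennreal (min (case_prod c p / 2) (real n))) \<in> borel_measurable borel"
        using lsc_borel[OF c(1)] by measurable
      fix p :: "'a \<times> 'a"
      obtain u v where p: "p = (u, v)" by fastforce
      let ?W = "wasserstein (\<lambda>u v. min (C * c' u v) (real n)) (P u) (P v)"
      have "?W \<le> wasserstein (\<lambda>u v. C * c' u v) (P u) (P v)" by (rule wasserstein_mono) simp
      also have "\<dots> \<le> ennreal C * wasserstein c' (P u) (P v)"
        by (rule wasserstein_cmult[OF C lsc_borel[OF c'(1)] c'(2)])
      also have "\<dots> \<le> ennreal C * ennreal (\<kappa> * c u v)" by (intro mult_left_mono contr) simp
      also have "\<dots> = ennreal ((C * \<kappa>) * c u v)"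
        using C \<kappa> c(2) by (simp add: ennreal_mult[symmetric] mult.assoc)
      also have "\<dots> \<le> ennreal (1 / 2 * c u v)" by (intro ennreal_leI mult_right_mono \<kappa> c)
      finally have "?W \<le> ennreal (c u v / 2)" by simp
      moreover have "?W \<le> ennreal (real n)"
        by (rule wasserstein_bounded) (auto intro: markov_kernel_Pr[OF PQ(1)])
      ultimately show "wasserstein (\<lambda>u v. min (C * c' u v) (real n)) (P (fst p)) (P (snd p))
          \<le> ennreal (min (case_prod c p / 2) (real n))"
        unfolding p by (simp add: min_def)
    qed
    ultimately show ?thesis by simp
  qed
  also have "wasserstein (\<lambda>u v. C * c' u v) (\<nu> \<bind> P) \<nu> \<le> ennreal C * (\<integral>\<^sup>+u. F u \<partial>\<nu>)"
  proof -
    have "wasserstein (\<lambda>u v. C * c' u v) (\<nu> \<bind> P) (\<nu> \<bind> Q) \<le> ennreal C * wasserstein c' (\<nu> \<bind> P) (\<nu> \<bind> Q)"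
      by (rule wasserstein_cmult[OF C lsc_borel[OF c'(1)] c'(2)])
    also have "\<dots> \<le> ennreal C * (\<integral>\<^sup>+u. F u \<partial>\<nu>)"
      by (intro mult_left_mono wasserstein_mixture[OF \<nu>(1) PQ c' F]) simp
    finally show ?thesis unfolding \<nu>(2) .
  qed
  finally show "wasserstein (\<lambda>u v. min (c u v) (real n)) \<mu> \<nu>
      \<le> (\<integral>\<^sup>+p. ennreal (min (case_prod c p / 2) (real n)) \<partial>\<Gamma>) + ennreal C * (\<integral>\<^sup>+u. F u \<partial>\<nu>)"
    by (simp add: add_mono)
qed

theorem theorem2p3:
  fixes \<Lambda> :: "('a::{banach, second_countable_topology} \<Rightarrow> 'a \<Rightarrow> real) set"
    and \<Theta> :: "'p set"
    and P :: "'p \<Rightarrow> real \<Rightarrow> 'a \<Rightarrow> 'a measure"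
    and \<mu> :: "'p \<Rightarrow> 'a measure"
    and \<gamma> \<alpha>' :: real
    and \<theta>\<^sub>0 :: 'p
    and g :: "real \<Rightarrow> ('a \<Rightarrow> 'a \<Rightarrow> real) \<Rightarrow> 'p \<Rightarrow> real"
    and R :: "real \<Rightarrow> ('a \<Rightarrow> 'a \<Rightarrow> real) \<Rightarrow> real \<Rightarrow> real"
    and f :: "real \<Rightarrow> ('a \<Rightarrow> 'a \<Rightarrow> real) \<Rightarrow> 'a \<Rightarrow> ennreal"
  assumes Lambda: "\<forall>\<rho>\<in>\<Lambda>. distance_like \<rho> \<and> (\<forall>u v. \<rho> u v \<le> 1)"
    and kernels: "\<forall>\<theta>\<in>\<Theta>. \<forall>t\<ge>0. markov_kernel (P \<theta> t)"
    and H1: "\<gamma> \<ge> 1"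
      "\<forall>\<rho>\<in>\<Lambda>. \<forall>\<alpha>>0. \<exists>C>0. \<forall>u v w.
         weighted \<rho> \<alpha> u v \<le> C * (weighted \<rho> (\<gamma> * \<alpha>) u w + weighted \<rho> (\<gamma> * \<alpha>) w v)"
    and H2: "\<forall>\<theta>\<in>\<Theta>. \<mu> \<theta> \<in> Pr \<and> (\<forall>t\<ge>0. \<mu> \<theta> \<bind> P \<theta> t = \<mu> \<theta>)"
    and H3: "\<theta>\<^sub>0 \<in> \<Theta>" "\<alpha>' > 0"
      "\<forall>\<alpha>\<in>{0<..\<alpha>'}. \<forall>\<rho>\<in>\<Lambda>.
         (\<forall>\<theta>\<in>\<Theta>. 0 \<le> g \<alpha> \<rho> \<theta>) \<and> (\<forall>t\<ge>0. 0 \<le> R \<alpha> \<rho> t) \<and> f \<alpha> \<rho> \<in> borel_measurable borel \<and>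
         (\<forall>\<theta>\<in>\<Theta>. \<forall>t\<ge>0. \<forall>u.
            wasserstein (weighted \<rho> \<alpha>) (P \<theta> t u) (P \<theta>\<^sub>0 t u)
              \<le> ennreal (R \<alpha> \<rho> t) * f \<alpha> \<rho> u * ennreal (g \<alpha> \<rho> \<theta>))"
    and H4: "\<forall>m\<ge>1. \<exists>\<alpha>\<^sub>m>0. \<forall>\<alpha>\<in>{0<..\<alpha>\<^sub>m}. \<exists>\<rho>\<in>\<Lambda>. \<exists>T>0. \<exists>C\<^sub>1>0. \<exists>C\<^sub>2>0.
         \<forall>\<nu>\<in>Pr. \<forall>\<nu>'\<in>Pr. \<forall>t\<ge>T.
           (SUP \<theta>\<in>\<Theta> - {\<theta>\<^sub>0}. wasserstein (weighted \<rho> \<alpha>) (\<nu> \<bind> P \<theta> t) (\<nu>' \<bind> P \<theta> t))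
             \<le> ennreal (C\<^sub>1 * exp (- t * C\<^sub>2)) * wasserstein (weighted \<rho> (\<alpha> / m)) \<nu> \<nu>'"
  shows "\<exists>\<alpha>\<^sub>s>0. \<gamma> * \<alpha>\<^sub>s \<le> \<alpha>' \<and>
           (\<forall>\<alpha>\<in>{0<..\<alpha>\<^sub>s}. \<exists>\<rho>\<in>\<Lambda>. \<exists>T>0. \<exists>C>0. \<forall>\<theta>\<in>\<Theta>.
              wasserstein (weighted \<rho> \<alpha>) (\<mu> \<theta>) (\<mu> \<theta>\<^sub>0)
                \<le> ennreal C * ennreal (R (\<gamma> * \<alpha>) \<rho> T) * ennreal (g (\<gamma> * \<alpha>) \<rho> \<theta>)
                    * (\<integral>\<^sup>+ u. f (\<gamma> * \<alpha>) \<rho> u \<partial>\<mu> \<theta>\<^sub>0))"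
proof -
  obtain \<alpha>\<^sub>m where \<alpha>\<^sub>m: "\<alpha>\<^sub>m > 0"
    "\<forall>\<alpha>\<in>{0<..\<alpha>\<^sub>m}. \<exists>\<rho>\<in>\<Lambda>. \<exists>T>0. \<exists>C\<^sub>1>0. \<exists>C\<^sub>2>0.
         \<forall>\<nu>\<in>Pr. \<forall>\<nu>'\<in>Pr. \<forall>t\<ge>T.
           (SUP \<theta>\<in>\<Theta> - {\<theta>\<^sub>0}. wasserstein (weighted \<rho> \<alpha>) (\<nu> \<bind> P \<theta> t) (\<nu>' \<bind> P \<theta> t))
             \<le> ennreal (C\<^sub>1 * exp (- t * C\<^sub>2)) * wasserstein (weighted \<rho> (\<alpha> / \<gamma>)) \<nu> \<nu>'"
    using H4[rule_format, OF H1(1)] by (elim exE conjE)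
  have \<gamma>: "0 < \<gamma>" using H1(1) by simp
  \<comment> \<open>Both the contraction with \<open>m = \<gamma>\<close> and the comparison of kernels are applied at the exponent \<open>\<gamma> * \<alpha>\<close>.\<close>
  define \<alpha>\<^sub>s where "\<alpha>\<^sub>s = min \<alpha>\<^sub>m \<alpha>' / \<gamma>"
  have \<alpha>\<^sub>s: "0 < \<alpha>\<^sub>s" "\<gamma> * \<alpha>\<^sub>s \<le> \<alpha>'" "\<gamma> * \<alpha>\<^sub>s \<le> \<alpha>\<^sub>m"
    using \<gamma> \<alpha>\<^sub>m(1) H3(2) by (simp_all add: \<alpha>\<^sub>s_def)
  have "\<exists>\<rho>\<in>\<Lambda>. \<exists>T>0. \<exists>C>0. \<forall>\<theta>\<in>\<Theta>.
              wasserstein (weighted \<rho> \<alpha>) (\<mu> \<theta>) (\<mu> \<theta>\<^sub>0)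
                \<le> ennreal C * ennreal (R (\<gamma> * \<alpha>) \<rho> T) * ennreal (g (\<gamma> * \<alpha>) \<rho> \<theta>)
                    * (\<integral>\<^sup>+ u. f (\<gamma> * \<alpha>) \<rho> u \<partial>\<mu> \<theta>\<^sub>0)" if \<alpha>: "\<alpha> \<in> {0<..\<alpha>\<^sub>s}" for \<alpha>
  proof -
    have "\<gamma> * \<alpha> \<le> \<gamma> * \<alpha>\<^sub>s" "0 < \<gamma> * \<alpha>" using \<alpha> \<gamma> by auto
    then have \<beta>: "\<gamma> * \<alpha> \<in> {0<..\<alpha>\<^sub>m}" "\<gamma> * \<alpha> \<in> {0<..\<alpha>'}" using \<alpha>\<^sub>s by auto
    have \<gamma>\<alpha>: "\<gamma> * \<alpha> / \<gamma> = \<alpha>" using \<gamma> by simp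
    obtain \<rho> T\<^sub>1 C\<^sub>1 C\<^sub>2 where \<rho>: "\<rho> \<in> \<Lambda>" and T\<^sub>1: "T\<^sub>1 > 0" and C\<^sub>1: "C\<^sub>1 > 0" and C\<^sub>2: "C\<^sub>2 > 0"
      and contr: "\<forall>\<nu>\<in>Pr. \<forall>\<nu>'\<in>Pr. \<forall>t\<ge>T\<^sub>1.
           (SUP \<theta>\<in>\<Theta> - {\<theta>\<^sub>0}. wasserstein (weighted \<rho> (\<gamma> * \<alpha>)) (\<nu> \<bind> P \<theta> t) (\<nu>' \<bind> P \<theta> t))
             \<le> ennreal (C\<^sub>1 * exp (- t * C\<^sub>2)) * wasserstein (weighted \<rho> \<alpha>) \<nu> \<nu>'"
      using bspec[OF \<alpha>\<^sub>m(2) \<beta>(1)] unfolding \<gamma>\<alpha> by (elim bexE exE conjE)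
    obtain C where C: "C > 0" "\<forall>u v w.
         weighted \<rho> \<alpha> u v \<le> C * (weighted \<rho> (\<gamma> * \<alpha>) u w + weighted \<rho> (\<gamma> * \<alpha>) w v)"
      using H1(2) \<rho> \<alpha> by (meson greaterThanAtMost_iff)
    have d: "distance_like \<rho>" and le1: "\<rho> u v \<le> 1" for u v using Lambda \<rho> by auto
    have \<rho>0: "\<rho> u u = 0" for u using d by (simp add: distance_like_def)
    \<comment> \<open>The time after which \<open>C * C\<^sub>1 * exp (- T * C\<^sub>2) \<le> 1/2\<close>.\<close>
    define T where "T = max T\<^sub>1 (ln (2 * C * C\<^sub>1) / C\<^sub>2)"
    have T: "T > 0" "T \<ge> T\<^sub>1" using T\<^sub>1 by (auto simp: T_def)
    define \<kappa> where "\<kappa> = C\<^sub>1 * exp (- T * C\<^sub>2)"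
    have \<kappa>: "0 \<le> \<kappa>" "C * \<kappa> \<le> 1/2"
    proof -
      show "0 \<le> \<kappa>" using C\<^sub>1 by (simp add: \<kappa>_def)
      have "ln (2 * C * C\<^sub>1) / C\<^sub>2 \<le> T" by (simp add: T_def)
      then have "ln (2 * C * C\<^sub>1) \<le> T * C\<^sub>2" using C\<^sub>2 by (simp add: field_simps)
      then have "exp (ln (2 * C * C\<^sub>1)) \<le> exp (T * C\<^sub>2)" by simp
      then have "2 * C * C\<^sub>1 \<le> exp (T * C\<^sub>2)" using C(1) C\<^sub>1 by simp
      then show "C * \<kappa> \<le> 1/2" by (simp add: \<kappa>_def exp_minus field_simps)
    qed
    have H3': "(\<forall>\<theta>\<in>\<Theta>. 0 \<le> g (\<gamma> * \<alpha>) \<rho> \<theta>) \<and> (\<forall>t\<ge>0. 0 \<le> R (\<gamma> * \<alpha>) \<rho> t) \<and>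
         f (\<gamma> * \<alpha>) \<rho> \<in> borel_measurable borel \<and>
         (\<forall>\<theta>\<in>\<Theta>. \<forall>t\<ge>0. \<forall>u.
            wasserstein (weighted \<rho> (\<gamma> * \<alpha>)) (P \<theta> t u) (P \<theta>\<^sub>0 t u)
              \<le> ennreal (R (\<gamma> * \<alpha>) \<rho> t) * f (\<gamma> * \<alpha>) \<rho> u * ennreal (g (\<gamma> * \<alpha>) \<rho> \<theta>))"
      by (rule bspec[OF bspec[OF H3(3) \<beta>(2)] \<rho>])
    then have fm: "f (\<gamma> * \<alpha>) \<rho> \<in> borel_measurable borel" by (elim conjE)
    note lw = lsc_weighted[OF d]
    have "wasserstein (weighted \<rho> \<alpha>) (\<mu> \<theta>) (\<mu> \<theta>\<^sub>0)
                \<le> ennreal (2 * C) * ennreal (R (\<gamma> * \<alpha>) \<rho> T) * ennreal (g (\<gamma> * \<alpha>) \<rho> \<theta>)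
                    * (\<integral>\<^sup>+ u. f (\<gamma> * \<alpha>) \<rho> u \<partial>\<mu> \<theta>\<^sub>0)" if \<theta>: "\<theta> \<in> \<Theta>" for \<theta>
    \<comment> \<open>The contraction is not assumed at \<open>\<theta>\<^sub>0\<close>, where the left-hand side vanishes.\<close>
    proof (cases "\<theta> = \<theta>\<^sub>0")
      case True
      have "wasserstein (weighted \<rho> \<alpha>) (\<mu> \<theta>\<^sub>0) (\<mu> \<theta>\<^sub>0) = 0"
        using H2 H3(1) lsc_borel[OF lw] by (intro wasserstein_self) (auto simp: weighted_def \<rho>0)
      then show ?thesis using True by simp
    next
      case False
      let ?F = "\<lambda>u. ennreal (R (\<gamma> * \<alpha>) \<rho> T) * f (\<gamma> * \<alpha>) \<rho> u * ennreal (g (\<gamma> * \<alpha>) \<rho> \<theta>)"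
      have k: "markov_kernel (P \<theta> T)" "markov_kernel (P \<theta>\<^sub>0 T)" using kernels \<theta> H3(1) T(1) by auto
      have "wasserstein (weighted \<rho> \<alpha>) (\<mu> \<theta>) (\<mu> \<theta>\<^sub>0) \<le> 2 * (ennreal C * (\<integral>\<^sup>+u. ?F u \<partial>\<mu> \<theta>\<^sub>0))"
      proof (rule invariant_measures_close[OF _ _ _ _ k lw weighted_nonneg[OF d] lw weighted_nonneg[OF d] _ _ C(1) _ \<kappa>])
        show "\<mu> \<theta> \<in> Pr" "\<mu> \<theta> \<bind> P \<theta> T = \<mu> \<theta>" "\<mu> \<theta>\<^sub>0 \<in> Pr" "\<mu> \<theta>\<^sub>0 \<bind> P \<theta>\<^sub>0 T = \<mu> \<theta>\<^sub>0"
          using H2 \<theta> H3(1) T(1) by auto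
        show "(\<lambda>u. exp (2 * \<alpha> * (norm u)\<^sup>2)) \<in> borel_measurable borel" by measurable
        show "weighted \<rho> \<alpha> u v \<le> exp (2 * \<alpha> * (norm u)\<^sup>2) + exp (2 * \<alpha> * (norm v)\<^sup>2)" for u v
          by (rule weighted_le_sum[OF d le1])
        show "weighted \<rho> \<alpha> u v \<le> C * (weighted \<rho> (\<gamma> * \<alpha>) u w + weighted \<rho> (\<gamma> * \<alpha>) w v)" for u v w
          using C(2) by blast
        show "?F \<in> borel_measurable borel" using fm by measurable
        show "wasserstein (weighted \<rho> (\<gamma> * \<alpha>)) (P \<theta> T u) (P \<theta>\<^sub>0 T u) \<le> ?F u" for u
          using H3' \<theta> T(1) by (elim conjE) (simp add: less_imp_le)
        fix u v
        have r: "return borel w \<bind> P \<theta> T = P \<theta> T w" for w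
          by (rule bind_return[OF measurable_prob_algebraD[OF k(1)]]) simp
        have "wasserstein (weighted \<rho> (\<gamma> * \<alpha>)) (P \<theta> T u) (P \<theta> T v)
            \<le> (SUP \<theta>\<in>\<Theta> - {\<theta>\<^sub>0}. wasserstein (weighted \<rho> (\<gamma> * \<alpha>)) (return borel u \<bind> P \<theta> T) (return borel v \<bind> P \<theta> T))"
          by (rule SUP_upper2[of \<theta>]) (use \<theta> False in \<open>simp_all add: r\<close>)
        also have "\<dots> \<le> ennreal \<kappa> * wasserstein (weighted \<rho> \<alpha>) (return borel u) (return borel v)"
          unfolding \<kappa>_def by (rule contr[rule_format, OF return_Pr return_Pr T(2)])
        also have "\<dots> \<le> ennreal \<kappa> * ennreal (weighted \<rho> \<alpha> u v)"
          by (intro mult_left_mono wasserstein_return lsc_borel[OF lw]) simp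
        also have "\<dots> = ennreal (\<kappa> * weighted \<rho> \<alpha> u v)"
          using \<kappa>(1) weighted_nonneg[OF d] by (simp add: ennreal_mult)
        finally show "wasserstein (weighted \<rho> (\<gamma> * \<alpha>)) (P \<theta> T u) (P \<theta> T v) \<le> ennreal (\<kappa> * weighted \<rho> \<alpha> u v)" .
      qed
      also have "(\<integral>\<^sup>+u. ?F u \<partial>\<mu> \<theta>\<^sub>0) = ennreal (R (\<gamma> * \<alpha>) \<rho> T) * (\<integral>\<^sup>+u. f (\<gamma> * \<alpha>) \<rho> u \<partial>\<mu> \<theta>\<^sub>0) * ennreal (g (\<gamma> * \<alpha>) \<rho> \<theta>)"
      proof -
        have "sets (\<mu> \<theta>\<^sub>0) = sets borel" using H2 H3(1) by (auto simp: Pr_iff)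
        then have "f (\<gamma> * \<alpha>) \<rho> \<in> borel_measurable (\<mu> \<theta>\<^sub>0)" using fm by (simp cong: measurable_cong_sets)
        then show ?thesis by (simp add: nn_integral_cmult nn_integral_multc)
      qed
      finally show ?thesis using C(1) by (simp add: ennreal_mult mult_ac)
    qed
    moreover have "0 < 2 * C" using C(1) by simp
    ultimately have "\<exists>C>0. \<forall>\<theta>\<in>\<Theta>. wasserstein (weighted \<rho> \<alpha>) (\<mu> \<theta>) (\<mu> \<theta>\<^sub>0)
                \<le> ennreal C * ennreal (R (\<gamma> * \<alpha>) \<rho> T) * ennreal (g (\<gamma> * \<alpha>) \<rho> \<theta>)
                    * (\<integral>\<^sup>+ u. f (\<gamma> * \<alpha>) \<rho> u \<partial>\<mu> \<theta>\<^sub>0)"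
      by blast
    then show ?thesis using \<rho> T(1) by blast
  qed
  then show ?thesis using \<alpha>\<^sub>s by blast
qed

end
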